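(* Let $k>2$ be an even integer that is not of the form $2^t$ for any integer $t\ge 2$. Then the line graph $L(B(2k+1,k))$ is a vertex-transitive non-Cayley graph.
   Context: For integers $n\ge 4$ and $1\le k<\frac n2$, let $[n]=\{1,\dots,n\}$. The graph $B(n,k)$ has vertex set $V=\{v\subset[n] : |v|\in\{k,k+1\}\}$, and two vertices $v,w$ are adjacent iff $v\subset w$ or $w\subset v$ (for $n=2k+1$ this is the middle layer graph of the hypercube $Q_{2k+1}$). The line graph $L(\Gamma)$ has the edges of $\Gamma$ as vertices, two being adjacent iff the edges share an endpoint. A graph is a Cayley graph if it is isomorphic to some $\mathrm{Cay}(G;\Omega)$ (vertex set a group $G$, $\Omega=\Omega^{-1}\not\ni 1$, $g\sim h$ iff $g^{-1}h\in\Omega$). *)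

theory Defs
  imports "HOL-Algebra.Group"
begin

text \<open>A simple graph is a pair (V, E) of a vertex set and a set of edges,
each edge being a 2-element set of vertices.\<close>
type_synonym 'a graph = "'a set \<times> 'a set set"

definition verts :: "'a graph \<Rightarrow> 'a set" where "verts G = fst G"
definition edges :: "'a graph \<Rightarrow> 'a set set" where "edges G = snd G"

definition adj :: "'a graph \<Rightarrow> 'a \<Rightarrow> 'a \<Rightarrow> bool" where
  "adj G x y \<longleftrightarrow> {x, y} \<in> edges G"

definition B_graph :: "nat \<Rightarrow> nat \<Rightarrow> nat set graph" where
  "B_graph n k =
     (let V = {v. v \<subseteq> {1..n} \<and> (card v = k \<or> card v = k + 1)}
      in (V, {{v, w} | v w. v \<in> V \<and> w \<in> V \<and> (v \<subset> w \<or> w \<subset> v)}))"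

definition line_graph :: "'a graph \<Rightarrow> 'a set graph" where
  "line_graph G =
     (edges G, {{e, f} | e f. e \<in> edges G \<and> f \<in> edges G \<and> e \<noteq> f \<and> e \<inter> f \<noteq> {}})"

definition graph_iso :: "('a \<Rightarrow> 'b) \<Rightarrow> 'a graph \<Rightarrow> 'b graph \<Rightarrow> bool" where
  "graph_iso f G H \<longleftrightarrow> bij_betw f (verts G) (verts H) \<and>
     (\<forall>x\<in>verts G. \<forall>y\<in>verts G. adj G x y \<longleftrightarrow> adj H (f x) (f y))"

definition isomorphic_graphs :: "'a graph \<Rightarrow> 'b graph \<Rightarrow> bool" where
  "isomorphic_graphs G H \<longleftrightarrow> (\<exists>f. graph_iso f G H)"

definition vertex_transitive :: "'a graph \<Rightarrow> bool" where
  "vertex_transitive G \<longleftrightarrow>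
     (\<forall>x\<in>verts G. \<forall>y\<in>verts G. \<exists>f. graph_iso f G G \<and> f x = y)"

definition cayley_graph :: "('g, 'm) monoid_scheme \<Rightarrow> 'g set \<Rightarrow> 'g graph" where
  "cayley_graph G \<Omega> =
     (carrier G, {{g, h} | g h. g \<in> carrier G \<and> h \<in> carrier G \<and> inv\<^bsub>G\<^esub> g \<otimes>\<^bsub>G\<^esub> h \<in> \<Omega>})"

definition connection_set :: "('g, 'm) monoid_scheme \<Rightarrow> 'g set \<Rightarrow> bool" where
  "connection_set G \<Omega> \<longleftrightarrow> \<Omega> \<subseteq> carrier G \<and> \<one>\<^bsub>G\<^esub> \<notin> \<Omega> \<and>
     (\<forall>w\<in>\<Omega>. inv\<^bsub>G\<^esub> w \<in> \<Omega>)"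

text \<open>Being a Cayley graph with respect to some group whose elements are of type 'g.
  Non-Cayley is stated as the negation for groups over an arbitrary type 'g.\<close>
definition is_cayley_over :: "'g itself \<Rightarrow> 'a graph \<Rightarrow> bool" where
  "is_cayley_over _ \<Gamma> \<longleftrightarrow>
     (\<exists>(G :: 'g monoid) \<Omega>. group G \<and> connection_set G \<Omega> \<and>
        isomorphic_graphs (cayley_graph G \<Omega>) \<Gamma>)"

end

theory Submission
  imports Defs "HOL-Algebra.Sylow" "HOL-Algebra.Multiplicative_Group"
begin

text \<open>
  Write \<open>n = 2k + 1\<close>. The graph \<open>B(n, k)\<close> is triangle-free with all degrees at least 3, so
  three or more pairwise intersecting edges share an endpoint, and every automorphism of the line
  graph comes from one of \<open>B(n, k)\<close>. Such an automorphism fixes or swaps the two layers; after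
  composing with complementation it preserves inclusion between them, descends through the layers
  below, and so comes from a permutation of the \<open>n\<close> points.

  If the line graph were a Cayley graph of \<open>G\<close>, then \<open>G\<close> would act regularly on the
  \<open>(2k + 1) * (2k choose k)\<close> edges. Since \<open>k\<close> is not a power of 2, this number is divisible by 4,
  so some involution of \<open>G\<close> preserves the layers and acts as a permutation \<open>\<sigma>\<close> of the points with
  \<open>\<sigma>\<^sup>2 = 1\<close>. As \<open>n\<close> is odd and \<open>k\<close> is even, \<open>\<sigma>\<close> has an invariant \<open>k\<close>-set \<open>A\<close> and a fixed point
  \<open>x \<notin> A\<close>, hence fixes the edge from \<open>A\<close> to \<open>A \<union> {x}\<close>, contradicting regularity.
\<close>

section \<open>Central binomial coefficients and involutions\<close>

lemma central_binomial_Suc: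
  "(2 * Suc m choose Suc m) = 2 * (Suc (2 * m) choose Suc m)"
proof -
  have "Suc (2 * m) - m = Suc m" by simp
  then have "(Suc (2 * m) choose m) = (Suc (2 * m) choose Suc m)"
    using binomial_symmetric[of m "Suc (2 * m)"] by simp
  moreover have "2 * Suc m = Suc (Suc (2 * m))" by simp
  ultimately show ?thesis by (simp only: binomial_Suc_Suc mult_2)
qed

text \<open>Tracks the power of 2 from one central coefficient to the next: besides the odd number
  \<open>2 * m + 1\<close>, only one factor 2 and the divisor \<open>Suc m\<close> enter.\<close>

lemma central_binomial_rec:
  "Suc m * (2 * Suc m choose Suc m) = 2 * (2 * m + 1) * (2 * m choose m)"
proof -
  define c where "c = (Suc (2 * m) choose Suc m)"
  have "Suc m * c = Suc (2 * m) * (2 * m choose m)"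
    unfolding c_def by (rule Suc_times_binomial)
  then have "2 * (Suc m * c) = 2 * (2 * m + 1) * (2 * m choose m)" by (simp only: Suc_eq_plus1 mult.assoc)
  then show ?thesis
    unfolding central_binomial_Suc c_def[symmetric] by (simp only: mult.left_commute)
qed

lemma even_central_binomial:
  assumes "m > 0"
  shows "even (2 * m choose m)"
proof -
  obtain l where "m = Suc l" using assms by (cases m) auto
  then show ?thesis using central_binomial_Suc[of l] by (metis dvd_triv_left)
qed

text \<open>Two steps of the recurrence lead from \<open>2 * m\<close> to \<open>2 * Suc m\<close>,
  one step leads from \<open>m\<close> to \<open>Suc m\<close>. The divisor \<open>m + 1\<close> and
  the factor 2 occur on both sides, and what remains is odd. The multipliers \<open>a\<close> and
  \<open>b\<close> express equality of 2-adic valuations without division.\<close>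

lemma central_binomial_double:
  "\<exists>a b. odd a \<and> odd b \<and> a * (2 * (2 * m) choose (2 * m)) = b * (2 * m choose m)"
proof (induction m)
  case 0
  show ?case by (intro exI[of _ 1]) simp
next
  case (Suc m)
  then obtain a b where ab: "odd a" "odd b"
    "a * (2 * (2 * m) choose (2 * m)) = b * (2 * m choose m)" by blast
  define c where "c = (\<lambda>n::nat. 2 * n choose n)"
  define c0 c1 d0 d1 d2 where "c0 = c m" and "c1 = c (Suc m)"
    and "d0 = c (2 * m)" and "d1 = c (Suc (2 * m))" and "d2 = c (2 * Suc m)"
  have rec: "Suc n * c (Suc n) = 2 * (2 * n + 1) * c n" for n
    unfolding c_def by (rule central_binomial_rec)
  have c: "(m + 1) * c1 = 2 * (2 * m + 1) * c0"
    using rec[of m] unfolding c0_def c1_def by simp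
  have d: "(2 * m + 1) * d1 = 2 * (4 * m + 1) * d0"
    using rec[of "2 * m"] unfolding d0_def d1_def by simp
  have e: "2 * (m + 1) * d2 = 2 * (4 * m + 3) * d1"
    using rec[of "Suc (2 * m)"] unfolding d1_def d2_def by (simp add: algebra_simps)
  have ab': "a * d0 = b * c0" using ab(3) unfolding c0_def d0_def c_def .
  have "2 * (m + 1) * (a * (2 * m + 1) ^ 2 * d2) = a * (2 * m + 1) * (2 * m + 1) * (2 * (m + 1) * d2)"
    by (simp only: power2_eq_square ac_simps)
  also have "\<dots> = 2 * (4 * m + 3) * a * (2 * m + 1) * ((2 * m + 1) * d1)"
    unfolding e by (simp only: ac_simps)
  also have "\<dots> = 2 * (4 * m + 3) * (4 * m + 1) * (2 * (2 * m + 1)) * (a * d0)"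
    unfolding d by (simp only: ac_simps)
  also have "\<dots> = 2 * (4 * m + 3) * (4 * m + 1) * b * (2 * (2 * m + 1) * c0)"
    unfolding ab' by (simp only: ac_simps)
  also have "\<dots> = 2 * (m + 1) * (b * (4 * m + 3) * (4 * m + 1) * c1)"
    unfolding c[symmetric] by (simp only: ac_simps)
  finally have "a * (2 * m + 1) ^ 2 * d2 = b * (4 * m + 3) * (4 * m + 1) * c1"
    by (subst (asm) mult_cancel1) simp
  moreover have "odd (a * (2 * m + 1) ^ 2)" "odd (b * (4 * m + 3) * (4 * m + 1))"
    using ab by auto
  ultimately show ?case unfolding c1_def d2_def c_def by blast
qed

text \<open>Halving an even \<open>k\<close> keeps the power of 2, so the claim reduces to odd
  \<open>k > 1\<close>. There the recurrence gives one factor 2, the even coefficient at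
  \<open>k - 1\<close> gives another, and \<open>k\<close> itself is coprime to 4.\<close>

lemma four_dvd_central_binomial:
  assumes "k > 0" and "\<nexists>t. k = 2 ^ t"
  shows "4 dvd (2 * k choose k)"
  using assms
proof (induction k rule: less_induct)
  case (less k)
  have cop: "coprime (4::nat) a" if "odd a" for a :: nat
  proof -
    have "coprime (2 ^ 2) a" using that by (simp only: coprime_power_left_iff coprime_left_2_iff_odd) simp
    then show ?thesis by simp
  qed
  show ?case
  proof (cases "even k")
    case True
    then obtain m where m: "k = 2 * m" by blast
    with less.prems have "m > 0" "m < k" by auto
    moreover have "\<nexists>t. m = 2 ^ t" using less.prems(2) m by (metis power_Suc)
    ultimately have "4 dvd (2 * m choose m)" using less.IH by blast
    moreover obtain a b where "odd a" and ab: "a * (2 * k choose k) = b * (2 * m choose m)"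
      using central_binomial_double[of m] unfolding m by blast
    ultimately have "4 dvd a * (2 * k choose k)" by simp
    then show ?thesis using cop[OF \<open>odd a\<close>] coprime_dvd_mult_right_iff by blast
  next
    case False
    obtain m where m: "k = Suc m" using less.prems(1) by (cases k) auto
    \<comment> \<open>The exponent 0 counts: \<open>k = 1\<close> is excluded as
      \<open>2 ^ 0\<close>, so the preceding coefficient is even.\<close>
    have "m \<noteq> 0"
    proof
      assume "m = 0"
      then have "k = 2 ^ 0" using m by simp
      then show False using less.prems(2) by blast
    qed
    then have "m > 0" by simp
    then obtain c where c: "(2 * m choose m) = 2 * c" using even_central_binomial by blast
    have "k * (2 * k choose k) = 4 * ((2 * m + 1) * c)"
      unfolding m central_binomial_rec c by simp
    then have "4 dvd k * (2 * k choose k)" by simp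
    then show ?thesis using cop[OF False] coprime_dvd_mult_right_iff by blast
  qed
qed

text \<open>The hypothesis on \<open>N\<close> says that it is a subgroup of index at most two.
  A subgroup of order 4 then meets it in an involution.\<close>
lemma (in group) involution_in_index_two_set:
  assumes fin: "finite (carrier G)" and dvd: "4 dvd order G"
    and N: "\<And>a b. a \<in> carrier G \<Longrightarrow> b \<in> carrier G \<Longrightarrow> a \<in> N \<longleftrightarrow> b \<in> N \<Longrightarrow> a \<otimes> b \<in> N"
  shows "\<exists>g \<in> carrier G \<inter> N. g \<noteq> \<one> \<and> g \<otimes> g = \<one>"
proof -
  \<comment> \<open>Sylow's theorem is applied to the divisor 4, which may be less than the full
    power of 2 in the order.\<close>
  obtain m where "order G = 2 ^ 2 * m" using dvd by auto
  then obtain H where H: "subgroup H G" "card H = 4"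
    using sylow_thm[OF two_is_prime_nat is_group _ fin] by fastforce
  interpret H: subgroup H G by fact
  have finH: "finite H" using H(2) by (metis card.infinite zero_neq_numeral)
  have HG: "group (G\<lparr>carrier := H\<rparr>)" by (rule H.subgroup_is_group[OF is_group])
  have pow4: "(a \<otimes> a) \<otimes> (a \<otimes> a) = \<one>" if "a \<in> H" for a
  proof -
    have "a [^] (4::nat) = \<one>"
      using group.pow_order_eq_1[OF HG, of a] that H(2)
      by (simp add: order_def nat_pow_consistent[symmetric])
    then show ?thesis using that by (simp add: numeral_eq_Suc m_assoc)
  qed
  show ?thesis
  \<comment> \<open>If \<open>H\<close> is cyclic, the square of a generator lies in
    \<open>N\<close>, being a product of two elements with equal membership. Otherwise all elements
    of \<open>H\<close> square to \<open>\<one>\<close>, and of two distinct nontrivial ones either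
    one lies in \<open>N\<close> or their product does.\<close>
  proof (cases "\<exists>a\<in>H. a \<otimes> a \<noteq> \<one>")
    case True
    then obtain a where a: "a \<in> H" "a \<otimes> a \<noteq> \<one>" by blast
    then have "a \<otimes> a \<in> carrier G \<inter> N" using N[of a a] by simp
    then show ?thesis using a(2) pow4[OF a(1)] by blast
  next
    case False
    have "card (H - {\<one>}) = 3" using H(2) finH by simp
    then obtain a b where ab: "a \<in> H" "b \<in> H" "a \<noteq> \<one>" "b \<noteq> \<one>" "a \<noteq> b"
      by (metis (no_types, lifting) Diff_iff card_3_iff insertCI)
    have sq: "c \<otimes> c = \<one>" if "c \<in> H" for c using False that by blast
    have "a \<otimes> b \<noteq> \<one>"
    proof
      assume "a \<otimes> b = \<one>"
      then have "inv b = a" "inv b = b" using ab sq[of b] by (auto intro!: inv_equality)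
      then show False using ab by simp
    qed
    moreover have "a \<otimes> b \<in> H" using ab by simp
    moreover have "a \<in> N \<or> b \<in> N \<or> a \<otimes> b \<in> N" using N[of a b] ab by auto
    ultimately show ?thesis using ab sq H.subset by blast
  qed
qed

text \<open>An invariant set grows by two elements at a time: outside it there is either a pair
  swapped by \<open>\<sigma>\<close>, or there are only fixed points, any two of which will
  do.\<close>

lemma invariant_subset_of_even_card:
  fixes \<sigma> :: "'a \<Rightarrow> 'a"
  assumes "finite S" and "\<And>x. x \<in> S \<Longrightarrow> \<sigma> x \<in> S" and inv: "\<And>x. x \<in> S \<Longrightarrow> \<sigma> (\<sigma> x) = x"
    and "2 * j \<le> card S"
  shows "\<exists>A\<subseteq>S. card A = 2 * j \<and> \<sigma> ` A = A"
  using assms(4)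
proof (induction j)
  case 0
  show ?case by (intro exI[of _ "{}"]) simp
next
  case (Suc j)
  then obtain A where A: "A \<subseteq> S" "card A = 2 * j" "\<sigma> ` A = A" by auto
  have fA: "finite A" using A(1) assms(1) by (rule finite_subset)
  have "card (S - A) \<ge> 2" using Suc.prems A fA by (simp add: card_Diff_subset)
  then obtain T where "T \<subseteq> S - A" "card T = 2" by (meson obtain_subset_with_card_n)
  then obtain x y where xy: "x \<in> S - A" "y \<in> S - A" "x \<noteq> y"
    by (metis card_2_iff' subset_eq)
  have out: "\<sigma> z \<in> S - A" if "z \<in> S - A" for z
    using that A assms(2) inv by (metis DiffD1 DiffD2 DiffI imageI)
  obtain u v where uv: "u \<in> S - A" "v \<in> S - A" "u \<noteq> v" "\<sigma> ` {u, v} = {u, v}"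
  proof (cases "\<exists>z\<in>S - A. \<sigma> z \<noteq> z")
    case True
    then obtain z where "z \<in> S - A" "\<sigma> z \<noteq> z" by blast
    then show ?thesis using that[of z "\<sigma> z"] out inv by auto
  next
    case False
    then show ?thesis using that[of x y] xy by simp
  qed
  have "card (A \<union> {u, v}) = 2 * Suc j"
    using uv A(2) fA by (subst card_Un_disjoint) auto
  moreover have "\<sigma> ` (A \<union> {u, v}) = A \<union> {u, v}" using A(3) uv(4) by (metis image_Un)
  ultimately show ?case using A(1) uv by (intro exI[of _ "A \<union> {u, v}"]) auto
qed

section \<open>Automorphisms of line graphs\<close>

lemma verts_line_graph: "verts (line_graph G) = edges G"
  by (simp add: verts_def line_graph_def)

lemma adj_line_graph:
  "adj (line_graph G) e f \<longleftrightarrow> e \<in> edges G \<and> f \<in> edges G \<and> e \<noteq> f \<and> e \<inter> f \<noteq> {}"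
  unfolding adj_def line_graph_def edges_def by (auto simp: doubleton_eq_iff)

text \<open>Write \<open>e1 = {a, b}\<close> and \<open>e2 = {a, c}\<close>. If \<open>e3\<close>
  avoided \<open>a\<close>, it would be \<open>{b, c}\<close> and close a triangle. So three edges
  form a star at \<open>a\<close>, and a further edge avoiding \<open>a\<close> would need three
  distinct endpoints.\<close>

lemma intersecting_edges_common_vertex:
  assumes card2: "\<And>e. e \<in> edges G \<Longrightarrow> card e = 2"
    and tri: "\<And>a b c. adj G a b \<Longrightarrow> adj G b c \<Longrightarrow> \<not> adj G a c"
    and F: "F \<subseteq> edges G" "\<And>e f. e \<in> F \<Longrightarrow> f \<in> F \<Longrightarrow> e \<inter> f \<noteq> {}"
    and e: "e1 \<in> F" "e2 \<in> F" "e3 \<in> F" "e1 \<noteq> e2" "e1 \<noteq> e3" "e2 \<noteq> e3"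
  shows "\<exists>w. \<forall>e\<in>F. w \<in> e"
proof -
  have other: "\<exists>y. y \<noteq> x \<and> f = {x, y}" if "f \<in> F" "x \<in> f" for f x
  proof -
    have "card f = 2" using card2 F(1) that(1) by blast
    then show ?thesis using that(2) unfolding card_2_iff by auto
  qed
  obtain a where a: "a \<in> e1" "a \<in> e2" using F(2)[OF e(1,2)] by blast
  obtain b where b: "b \<noteq> a" "e1 = {a, b}" using other[OF e(1) a(1)] by blast
  obtain c where c: "c \<noteq> a" "e2 = {a, c}" using other[OF e(2) a(2)] by blast
  have "b \<noteq> c" using b c e(4) by blast
  have "a \<in> e3"
  proof (rule ccontr)
    assume "a \<notin> e3"
    then have bc: "b \<in> e3" "c \<in> e3"
      using F(2)[OF e(1,3)] F(2)[OF e(2,3)] b c by auto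
    then have "e3 = {b, c}" using other[OF e(3) bc(1)] \<open>b \<noteq> c\<close> by auto
    then have "adj G a b" "adj G b c" "adj G a c"
      using F(1) e b c by (auto simp: adj_def)
    then show False using tri by blast
  qed
  then obtain d where d: "d \<noteq> a" "e3 = {a, d}" using other[OF e(3)] by blast
  have "a \<in> f" if f: "f \<in> F" for f
  proof (rule ccontr)
    assume "a \<notin> f"
    then have "b \<in> f" "c \<in> f" "d \<in> f"
      using F(2)[OF e(1) f] F(2)[OF e(2) f] F(2)[OF e(3) f] b c d by auto
    moreover have "b \<noteq> d" "c \<noteq> d" using b c d e by auto
    ultimately show False using other[OF f \<open>b \<in> f\<close>] \<open>b \<noteq> c\<close> by auto
  qed
  then show ?thesis by blast
qed

text \<open>The edges at \<open>v\<close> form a star of at least three, so their images have a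
  common endpoint, which becomes \<open>\<psi> v\<close>. This is a case of Whitney's theorem on
  line graphs.\<close>

lemma line_graph_automorphism_induced:
  assumes fin: "finite (verts G)"
    and simple: "\<And>e. e \<in> edges G \<Longrightarrow> e \<subseteq> verts G \<and> card e = 2"
    and tri: "\<And>a b c. adj G a b \<Longrightarrow> adj G b c \<Longrightarrow> \<not> adj G a c"
    and deg: "\<And>v. v \<in> verts G \<Longrightarrow> card {w. adj G v w} \<ge> 3"
    and phi: "graph_iso \<phi> (line_graph G) (line_graph G)"
  shows "\<exists>\<psi>. graph_iso \<psi> G G \<and> (\<forall>e\<in>edges G. \<phi> e = \<psi> ` e)"
proof -
  have bij: "bij_betw \<phi> (edges G) (edges G)"
    using phi by (simp add: graph_iso_def verts_line_graph)
  \<comment> \<open>Adjacency in the line graph concerns distinct edges, so equal edges are treated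
    apart, by nonemptiness.\<close>
  have meet: "\<phi> e \<inter> \<phi> f \<noteq> {} \<longleftrightarrow> e \<inter> f \<noteq> {}" if "e \<in> edges G" "f \<in> edges G" for e f
  proof (cases "e = f")
    case True
    then show ?thesis using simple[OF that(1)] simple[OF bij_betwE[OF bij, rule_format, OF that(1)]]
      by auto
  next
    case False
    then have "\<phi> e \<noteq> \<phi> f" using bij that by (meson bij_betw_def inj_on_eq_iff)
    then show ?thesis
      using phi that False bij_betwE[OF bij] unfolding graph_iso_def verts_line_graph adj_line_graph by blast
  qed
  have neighbours: "\<exists>a b c. a \<noteq> b \<and> a \<noteq> c \<and> b \<noteq> c \<and> {v, a} \<in> edges G \<and> {v, b} \<in> edges G \<and> {v, c} \<in> edges G"
    if v: "v \<in> verts G" for v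
  proof -
    obtain T where "T \<subseteq> {w. adj G v w}" "card T = 3"
      using deg[OF v] by (meson obtain_subset_with_card_n)
    then show ?thesis unfolding adj_def card_3_iff by blast
  qed
  have "\<exists>w. \<forall>e\<in>edges G. v \<in> e \<longrightarrow> w \<in> \<phi> e" if v: "v \<in> verts G" for v
  proof -
    obtain a b c where abc: "a \<noteq> b" "a \<noteq> c" "b \<noteq> c"
      "{v, a} \<in> edges G" "{v, b} \<in> edges G" "{v, c} \<in> edges G"
      using neighbours[OF v] by blast
    let ?F = "\<phi> ` {e \<in> edges G. v \<in> e}"
    have ne: "\<phi> {v, x} \<noteq> \<phi> {v, y}" if "{v, x} \<in> edges G" "{v, y} \<in> edges G" "x \<noteq> y" for x y
      using bij that by (metis bij_betw_def doubleton_eq_iff inj_on_eq_iff)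
    have "\<exists>w. \<forall>e\<in>?F. w \<in> e"
    proof (rule intersecting_edges_common_vertex[of G ?F])
      show "?F \<subseteq> edges G" using bij_betwE[OF bij] by blast
      show "e \<inter> f \<noteq> {}" if "e \<in> ?F" "f \<in> ?F" for e f
        using that meet by blast
      show "\<phi> {v, a} \<in> ?F" "\<phi> {v, b} \<in> ?F" "\<phi> {v, c} \<in> ?F" using abc by auto
    qed (use simple tri ne abc in blast)+
    then show ?thesis by blast
  qed
  then obtain \<psi> where psi: "\<And>v e. v \<in> verts G \<Longrightarrow> e \<in> edges G \<Longrightarrow> v \<in> e \<Longrightarrow> \<psi> v \<in> \<phi> e"
    by metis
  have psi_verts: "\<psi> v \<in> verts G" if "v \<in> verts G" for v
    using neighbours[OF that] psi[OF that] simple bij_betwE[OF bij] by (metis insertI1 subsetD)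
  \<comment> \<open>If \<open>\<psi> u = \<psi> v\<close>, two disjoint edges at \<open>u\<close>
    and \<open>v\<close> would have meeting images. Three neighbours leave room for such edges,
    since \<open>q\<close> has to avoid both \<open>u\<close> and \<open>p\<close>.\<close>
  have inj: "inj_on \<psi> (verts G)"
  proof (rule inj_onI, rule ccontr)
    fix u v assume uv: "u \<in> verts G" "v \<in> verts G" "\<psi> u = \<psi> v" "u \<noteq> v"
    obtain a b c where "a \<noteq> b" "a \<noteq> c" "b \<noteq> c"
      "{u, a} \<in> edges G" "{u, b} \<in> edges G" "{u, c} \<in> edges G"
      using neighbours[OF uv(1)] by blast
    then obtain p where p: "{u, p} \<in> edges G" "p \<noteq> v" by metis
    obtain a b c where "a \<noteq> b" "a \<noteq> c" "b \<noteq> c"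
      "{v, a} \<in> edges G" "{v, b} \<in> edges G" "{v, c} \<in> edges G"
      using neighbours[OF uv(2)] by blast
    then obtain q where q: "{v, q} \<in> edges G" "q \<noteq> u" "q \<noteq> p" by metis
    have "\<psi> u \<in> \<phi> {u, p}" "\<psi> u \<in> \<phi> {v, q}"
      using psi[OF uv(1) p(1)] psi[OF uv(2) q(1)] uv(3) by auto
    then have "{u, p} \<inter> {v, q} \<noteq> {}" using meet[OF p(1) q(1)] by blast
    then show False using uv(4) p q by auto
  qed
  have ind: "\<phi> e = \<psi> ` e" if e: "e \<in> edges G" for e
  proof (rule sym, rule card_subset_eq)
    show "finite (\<phi> e)"
      using simple bij_betwE[OF bij] e fin by (meson finite_subset)
    show "\<psi> ` e \<subseteq> \<phi> e" using psi simple e by blast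
    have "card (\<psi> ` e) = 2"
      using simple[OF e] inj by (metis card_image inj_on_subset)
    then show "card (\<psi> ` e) = card (\<phi> e)" using simple bij_betwE[OF bij] e by simp
  qed
  have "bij_betw \<psi> (verts G) (verts G)"
    using inj psi_verts fin by (simp add: bij_betw_def endo_inj_surj image_subsetI)
  moreover have "adj G x y \<longleftrightarrow> adj G (\<psi> x) (\<psi> y)" if xy: "x \<in> verts G" "y \<in> verts G" for x y
  proof
    assume "adj G x y"
    then have "{x, y} \<in> edges G" by (simp add: adj_def)
    then have "\<psi> ` {x, y} \<in> edges G" using ind bij_betwE[OF bij] by metis
    then show "adj G (\<psi> x) (\<psi> y)" by (simp add: adj_def)
  next
    assume "adj G (\<psi> x) (\<psi> y)"
    then have "\<psi> ` {x, y} \<in> edges G" by (simp add: adj_def)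
    then obtain e where e: "e \<in> edges G" "\<phi> e = \<psi> ` {x, y}"
      using bij by (metis bij_betw_def imageE)
    then have "\<psi> ` e = \<psi> ` {x, y}" using ind by metis
    then have "e = {x, y}"
      using inj_on_image_eq_iff[OF inj, of e "{x, y}"] simple[OF e(1)] xy by simp
    then show "adj G x y" using e by (simp add: adj_def)
  qed
  ultimately show ?thesis using ind unfolding graph_iso_def by blast
qed

text \<open>The opposite direction, from a graph to its line graph; it supplies the automorphisms
  for vertex-transitivity.\<close>

lemma line_graph_automorphism_image:
  assumes simple: "\<And>e. e \<in> edges G \<Longrightarrow> e \<subseteq> verts G \<and> card e = 2"
    and psi: "graph_iso \<psi> G G"
  shows "graph_iso ((`) \<psi>) (line_graph G) (line_graph G)"
proof -
  have bij: "bij_betw \<psi> (verts G) (verts G)" using psi by (simp add: graph_iso_def)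
  then have inj: "inj_on \<psi> (verts G)" by (rule bij_betw_imp_inj_on)
  have ims: "(\<psi> ` e = \<psi> ` f) = (e = f)" "\<psi> ` e \<inter> \<psi> ` f = \<psi> ` (e \<inter> f)"
    if "e \<in> edges G" "f \<in> edges G" for e f
    using simple that inj_on_image_eq_iff[OF inj, of e f] inj_on_image_Int[OF inj, of e f] by auto
  have into: "\<psi> ` e \<in> edges G" if "e \<in> edges G" for e
    using simple[OF that] that psi by (auto simp: card_2_iff graph_iso_def adj_def)
  have onto: "e \<in> (`) \<psi> ` edges G" if e: "e \<in> edges G" for e
  proof -
    obtain x y where xy: "e = {x, y}" "x \<in> verts G" "y \<in> verts G"
      using simple[OF e] by (auto simp: card_2_iff)
    then obtain u v where uv: "u \<in> verts G" "v \<in> verts G" "x = \<psi> u" "y = \<psi> v"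
      using bij by (metis bij_betw_def imageE)
    then have "{u, v} \<in> edges G" using e xy psi by (auto simp: graph_iso_def adj_def)
    then show ?thesis using xy(1) uv(3,4) by (auto intro!: image_eqI[of _ _ "{u, v}"])
  qed
  have "inj_on ((`) \<psi>) (edges G)" using ims(1) by (auto intro: inj_onI)
  then have "bij_betw ((`) \<psi>) (edges G) (edges G)"
    using into onto by (auto simp: bij_betw_def)
  then show ?thesis using ims into
    unfolding graph_iso_def verts_line_graph adj_line_graph by auto
qed

section \<open>Inclusion-preserving maps between two layers\<close>

abbreviation ksubsets :: "'a set \<Rightarrow> nat \<Rightarrow> 'a set set" where
  "ksubsets X j \<equiv> {A. A \<subseteq> X \<and> card A = j}"

section \<open>Adjacency and triangles in the Johnson graph\<close>

lemma card_Un_of_common_subset: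
  assumes "finite A" "finite B" "card A = Suc i" "card B = Suc i" "A \<noteq> B"
    and "D \<subseteq> A \<inter> B" "card D = i"
  shows "card (A \<union> B) = Suc (Suc i)" and "A \<inter> B = D"
proof -
  have "card (A \<inter> B) \<noteq> Suc i"
    using assms by (metis card_subset_eq inf_le1 inf_le2)
  moreover have "card (A \<inter> B) \<le> Suc i" using assms by (metis card_mono inf_le1)
  moreover have "card (A \<inter> B) \<ge> i" using assms by (metis card_mono finite_Int)
  ultimately have *: "card (A \<inter> B) = i" by simp
  then show "A \<inter> B = D" using assms by (metis card_subset_eq finite_Int)
  show "card (A \<union> B) = Suc (Suc i)" using card_Un_Int[of A B] assms * by simp
qed

text \<open>Triangles have a common core or a common superset. If \<open>y\<close> and
  \<open>z\<close> violate both, then \<open>A \<union> C\<close> and \<open>B \<union> C\<close>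
  equal \<open>insert y C\<close>, so \<open>A \<union> B\<close> fits into
  \<open>insert y (C - {z})\<close>, which is too small.\<close>

lemma johnson_triangle:
  assumes fin: "finite A" "finite B" "finite C"
    and card: "card A = Suc i" "card B = Suc i" "card C = Suc i"
    and Un: "card (A \<union> B) = Suc (Suc i)" "card (A \<union> C) = Suc (Suc i)" "card (B \<union> C) = Suc (Suc i)"
  shows "A \<inter> B \<subseteq> C \<or> C \<subseteq> A \<union> B"
proof (rule ccontr)
  assume "\<not> ?thesis"
  then obtain y z where yz: "y \<in> A" "y \<in> B" "y \<notin> C" "z \<in> C" "z \<notin> A \<union> B" by blast
  have AC: "A \<union> C = insert y C"
    using card_subset_eq[of "A \<union> C" "insert y C"] fin card Un yz by auto
  have BC: "B \<union> C = insert y C"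
    using card_subset_eq[of "B \<union> C" "insert y C"] fin card Un yz by auto
  have "A \<union> B \<subseteq> insert y (C - {z})" using AC BC yz by blast
  then have "card (A \<union> B) \<le> card (insert y (C - {z}))" using fin by (intro card_mono) auto
  also have "\<dots> \<le> Suc i" using fin card yz by (simp add: card_insert_if)
  finally show False using Un by simp
qed

text \<open>If \<open>f A = f A'\<close>, every upper neighbour of \<open>A\<close> contains
  \<open>A'\<close>; but some point outside \<open>A\<close> can be added to \<open>A\<close>
  without reaching all of \<open>A'\<close>. Dually for \<open>g\<close>, by removing a point.
  Finiteness turns injectivity into bijectivity.\<close>

lemma inclusion_maps_bij:
  assumes X: "finite X" "Suc (Suc j) \<le> card X" "j > 0"
    and f: "f \<in> ksubsets X j \<rightarrow> ksubsets X j"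
    and g: "g \<in> ksubsets X (Suc j) \<rightarrow> ksubsets X (Suc j)"
    and incl: "\<forall>A\<in>ksubsets X j. \<forall>B\<in>ksubsets X (Suc j). A \<subseteq> B \<longleftrightarrow> f A \<subseteq> g B"
  shows "bij_betw f (ksubsets X j) (ksubsets X j)"
    and "bij_betw g (ksubsets X (Suc j)) (ksubsets X (Suc j))"
proof -
  note fg = incl[THEN bspec, THEN bspec]
  have finK: "finite (ksubsets X i)" for i
    using X(1) by (rule finite_subset[rotated, OF finite_Pow_iff[THEN iffD2]]) blast
  have "inj_on f (ksubsets X j)"
  proof (rule inj_onI, rule ccontr)
    fix A A' assume A: "A \<in> ksubsets X j" "A' \<in> ksubsets X j" "f A = f A'" "A \<noteq> A'"
    have finA: "finite A" "finite A'" using A X(1) by (auto intro: finite_subset)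
    obtain x where x: "x \<in> A'" "x \<notin> A"
      using A finA card_subset_eq[of A A'] by blast
    have "card (X - A) \<ge> 2" using A finA X by (simp add: card_Diff_subset)
    then have "\<not> X - A \<subseteq> {x}" using card_mono[of "{x}" "X - A"] by auto
    then obtain y where y: "y \<in> X - A" "y \<noteq> x" by blast
    have K: "insert y A \<in> ksubsets X (Suc j)" using A finA y by auto
    have "A' \<subseteq> insert y A" using fg[OF A(1) K] fg[OF A(2) K] A(3) by blast
    then show False using x y by blast
  qed
  then show "bij_betw f (ksubsets X j) (ksubsets X j)"
    using endo_inj_surj[OF finK funcset_image[OF f]] unfolding bij_betw_def by blast
  have "inj_on g (ksubsets X (Suc j))"
  proof (rule inj_onI, rule ccontr)
    fix B B' assume B: "B \<in> ksubsets X (Suc j)" "B' \<in> ksubsets X (Suc j)" "g B = g B'" "B \<noteq> B'"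
    have finB: "finite B" "finite B'" using B X(1) by (auto intro: finite_subset)
    obtain x where x: "x \<in> B" "x \<notin> B'"
      using B finB card_subset_eq[of B' B] by auto
    have "B \<noteq> {x}" using B X(3) by auto
    then obtain y where y: "y \<in> B" "y \<noteq> x" using x by blast
    have K: "B - {y} \<in> ksubsets X j" using B finB y by auto
    have "B - {y} \<subseteq> B'" using fg[OF K B(1)] fg[OF K B(2)] B(3) by blast
    then show False using x y by blast
  qed
  then show "bij_betw g (ksubsets X (Suc j)) (ksubsets X (Suc j))"
    using endo_inj_surj[OF finK funcset_image[OF g]] unfolding bij_betw_def by blast
qed

text \<open>The sets \<open>A \<supset> D\<close> with one more element are pairwise adjacent in the Johnson graph, but no
  three of them lie in a common \<open>(i + 2)\<close>-set. Both properties survive \<open>f\<close>, so their images share a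
  core of size \<open>i\<close>, which is \<open>h D\<close>.\<close>
lemma inclusion_maps_descend:
  assumes X: "finite X" "Suc i + 2 \<le> card X"
    and f: "f \<in> ksubsets X (Suc i) \<rightarrow> ksubsets X (Suc i)"
    and g: "g \<in> ksubsets X (Suc (Suc i)) \<rightarrow> ksubsets X (Suc (Suc i))"
    and incl: "\<forall>A\<in>ksubsets X (Suc i). \<forall>B\<in>ksubsets X (Suc (Suc i)). A \<subseteq> B \<longleftrightarrow> f A \<subseteq> g B"
  shows "\<exists>h. h \<in> ksubsets X i \<rightarrow> ksubsets X i \<and>
    (\<forall>D\<in>ksubsets X i. \<forall>A\<in>ksubsets X (Suc i). D \<subseteq> A \<longleftrightarrow> h D \<subseteq> f A)"
proof -
  let ?K = "ksubsets X"
  note fg = incl[THEN bspec, THEN bspec]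
  have bij: "bij_betw f (?K (Suc i)) (?K (Suc i))" "bij_betw g (?K (Suc (Suc i))) (?K (Suc (Suc i)))"
    using inclusion_maps_bij[OF X(1) _ _ f g incl] X(2) by simp_all
  have finK: "finite A" if "A \<subseteq> X" for A using that X(1) by (rule finite_subset)
  have fK: "f A \<in> ?K (Suc i)" if "A \<in> ?K (Suc i)" for A using f that by blast
  have f_inj: "f A \<noteq> f A'" if "A \<in> ?K (Suc i)" "A' \<in> ?K (Suc i)" "A \<noteq> A'" for A A'
    using inj_on_eq_iff[OF bij_betw_imp_inj_on[OF bij(1)] that(1,2)] that(3) by simp
  have Un_eq: "A \<union> A' = B"
    if "A \<in> ?K (Suc i)" "A' \<in> ?K (Suc i)" "A \<noteq> A'" "B \<in> ?K (Suc (Suc i))" "A \<subseteq> B" "A' \<subseteq> B" for A A' B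
  proof (rule card_seteq)
    show "finite B" "A \<union> A' \<subseteq> B" using that finK[of B] by auto
    have "\<not> A' \<subseteq> A" using that finK[of A] card_subset_eq[of A A'] by auto
    then have "A \<subset> A \<union> A'" by blast
    moreover have "finite (A \<union> A')" using that finK[of A] finK[of A'] by blast
    ultimately have "card A < card (A \<union> A')" by (metis psubset_card_mono)
    then show "card B \<le> card (A \<union> A')" using that by simp
  qed
  \<comment> \<open>The map \<open>g\<close> carries the common superset of two adjacent sets to a
    common superset of their images, so \<open>f\<close> preserves adjacency. The converse
    \<open>adj2\<close> pulls the superset back through surjectivity of \<open>g\<close>.\<close>
  have adj1: "f A \<union> f A' \<in> ?K (Suc (Suc i))"
    if A: "A \<in> ?K (Suc i)" "A' \<in> ?K (Suc i)" "A \<noteq> A'" "A \<union> A' \<in> ?K (Suc (Suc i))" for A A'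
  proof -
    have "f A \<subseteq> g (A \<union> A')" "f A' \<subseteq> g (A \<union> A')"
      using fg[OF A(1,4)] fg[OF A(2,4)] by auto
    then have "f A \<union> f A' = g (A \<union> A')" using Un_eq[OF fK fK f_inj] A g by blast
    then show ?thesis using g A(4) by auto
  qed
  have g_surj: "\<exists>B\<in>?K (Suc (Suc i)). C = g B" if "C \<in> ?K (Suc (Suc i))" for C
    using bij(2) that unfolding bij_betw_def by blast
  have adj2: "A \<union> A' \<in> ?K (Suc (Suc i))"
    if A: "A \<in> ?K (Suc i)" "A' \<in> ?K (Suc i)" "A \<noteq> A'" "f A \<union> f A' \<in> ?K (Suc (Suc i))" for A A'
  proof -
    obtain B where B: "B \<in> ?K (Suc (Suc i))" "f A \<union> f A' = g B" using g_surj[OF A(4)] by blast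
    then have "A \<subseteq> B" "A' \<subseteq> B" using fg[OF A(1) B(1)] fg[OF A(2) B(1)] by auto
    then have "A \<union> A' = B" using Un_eq A B by blast
    then show ?thesis using B by simp
  qed
  have "\<exists>D'\<in>?K i. \<forall>A\<in>?K (Suc i). D \<subseteq> A \<longleftrightarrow> D' \<subseteq> f A" if D: "D \<in> ?K i" for D
  proof -
    have finD: "finite D" using D finK by blast
    \<comment> \<open>Three points outside \<open>D\<close> are wanted: two of the resulting sets
      define the core \<open>D'\<close>, the third serves in \<open>down\<close>.\<close>
    have "card (X - D) \<ge> 3" using D finD X by (simp add: card_Diff_subset)
    then obtain T where "T \<subseteq> X - D" "card T = 3" by (meson obtain_subset_with_card_n)
    then obtain x1 x2 x3 where x: "x1 \<in> X - D" "x2 \<in> X - D" "x3 \<in> X - D" "x1 \<noteq> x2" "x1 \<noteq> x3" "x2 \<noteq> x3"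
      unfolding card_3_iff by blast
    define A1 A2 A3 where "A1 = insert x1 D" and "A2 = insert x2 D" and "A3 = insert x3 D"
    note A_def = A1_def A2_def A3_def
    have A: "A1 \<in> ?K (Suc i)" "A2 \<in> ?K (Suc i)" "A3 \<in> ?K (Suc i)"
      using D finD x by (auto simp: A_def)
    have ne: "A1 \<noteq> A2" "A1 \<noteq> A3" "A2 \<noteq> A3" using x by (auto simp: A_def)
    have SUn: "B \<union> C \<in> ?K (Suc (Suc i))" "B \<inter> C = D"
      if "B \<in> ?K (Suc i)" "C \<in> ?K (Suc i)" "B \<noteq> C" "D \<subseteq> B" "D \<subseteq> C" for B C
      using card_Un_of_common_subset[of B C i D] that finK D by auto
    define D' where "D' = f A1 \<inter> f A2"
    have f12: "f A1 \<union> f A2 \<in> ?K (Suc (Suc i))"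
      using adj1[OF A(1,2) ne(1)] SUn(1)[OF A(1,2) ne(1)] by (auto simp: A_def)
    have "card D' = i"
      using card_Un_Int[of "f A1" "f A2"] f12 fK[OF A(1)] fK[OF A(2)] finK unfolding D'_def by auto
    then have D': "D' \<in> ?K i" using fK[OF A(1)] unfolding D'_def by blast
    have up: "D' \<subseteq> f C" if C: "C \<in> ?K (Suc i)" "D \<subseteq> C" for C
    proof (cases "C = A1 \<or> C = A2")
      case True
      then show ?thesis unfolding D'_def by blast
    next
      case False
      then have neC: "A1 \<noteq> C" "A2 \<noteq> C" by auto
      have DA: "D \<subseteq> A1" "D \<subseteq> A2" by (auto simp: A_def)
      have "f A1 \<union> f C \<in> ?K (Suc (Suc i))" "f A2 \<union> f C \<in> ?K (Suc (Suc i))"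
        using adj1[OF A(1) C(1) neC(1) SUn(1)[OF A(1) C(1) neC(1) DA(1) C(2)]]
          adj1[OF A(2) C(1) neC(2) SUn(1)[OF A(2) C(1) neC(2) DA(2) C(2)]] .
      then have "D' \<subseteq> f C \<or> f C \<subseteq> f A1 \<union> f A2"
        using johnson_triangle[of "f A1" "f A2" "f C" i] f12 finK fK A C unfolding D'_def by blast
      \<comment> \<open>A triangle of the other kind pulls back through \<open>g\<close> to a set
        \<open>B = A1 \<union> A2\<close> containing \<open>C\<close>. Since \<open>C\<close> meets
        \<open>A1\<close> and \<open>A2\<close> only in \<open>D\<close>, this forces
        \<open>C = D\<close>, of the wrong size.\<close>
      moreover have "\<not> f C \<subseteq> f A1 \<union> f A2"
      proof
        assume *: "f C \<subseteq> f A1 \<union> f A2"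
        obtain B where B: "B \<in> ?K (Suc (Suc i))" "f A1 \<union> f A2 = g B" using g_surj[OF f12] by blast
        have sub: "A1 \<subseteq> B" "A2 \<subseteq> B" "C \<subseteq> B"
          using fg[OF _ B(1)] A C * B(2) by blast+
        have "A1 \<union> A2 = B" using Un_eq[OF A(1,2) ne(1) B(1)] sub by blast
        moreover have "C \<inter> A1 = D" "C \<inter> A2 = D"
          using SUn(2)[OF A(1) C(1) neC(1) DA(1) C(2)] SUn(2)[OF A(2) C(1) neC(2) DA(2) C(2)] by auto
        ultimately have "C = D" using sub C(2) by blast
        then show False using C D by auto
      qed
      ultimately show ?thesis by blast
    qed
    \<comment> \<open>If \<open>C\<close> misses part of \<open>D\<close>, it is still adjacent to
      every set of the star over \<open>D\<close>, so it lies in the union of any two of them.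
      Intersecting \<open>A1 \<union> A2\<close> with \<open>A1 \<union> A3\<close> leaves only
      \<open>A1\<close>.\<close>
    have down: "D \<subseteq> C" if C: "C \<in> ?K (Suc i)" "D' \<subseteq> f C" for C
    proof (rule ccontr)
      assume nD: "\<not> D \<subseteq> C"
      have U: "card (Am \<union> C) = Suc (Suc i)" if Am: "Am \<in> ?K (Suc i)" "D \<subseteq> Am" for Am
      proof -
        have "Am \<noteq> C" using nD Am by blast
        moreover have "card (f Am \<union> f C) = Suc (Suc i)"
          using card_Un_of_common_subset(1)[of "f Am" "f C" i D'] finK fK[OF Am(1)] fK[OF C(1)]
            f_inj[OF Am(1) C(1)] \<open>Am \<noteq> C\<close> up[OF Am] C(2) D' by auto
        ultimately show ?thesis using adj2[OF Am(1) C(1)] fK[OF Am(1)] fK[OF C(1)] by auto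
      qed
      have DA: "D \<subseteq> A1" "D \<subseteq> A2" "D \<subseteq> A3" by (auto simp: A_def)
      have "C \<subseteq> Am \<union> An" if m: "Am \<in> ?K (Suc i)" "D \<subseteq> Am" "An \<in> ?K (Suc i)" "D \<subseteq> An" "Am \<noteq> An" for Am An
      proof -
        have "Am \<inter> An \<subseteq> C \<or> C \<subseteq> Am \<union> An"
          using johnson_triangle[of Am An C i] finK m C U[OF m(1,2)] U[OF m(3,4)] SUn(1)[OF m(1,3,5,2,4)]
          by blast
        then show ?thesis using nD m by blast
      qed
      then have "C \<subseteq> A1 \<union> A2" "C \<subseteq> A1 \<union> A3" using A DA ne by blast+
      then have "C \<subseteq> A1" using x by (auto simp: A_def)
      then have "C = A1" using A(1) C(1) finK card_subset_eq[of A1 C] by auto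
      then show False using nD DA by blast
    qed
    show ?thesis by (intro bexI[OF _ D'] ballI iffI) (erule (1) up, erule (1) down)
  qed
  then have "\<forall>D\<in>?K i. \<exists>D'. D' \<in> ?K i \<and> (\<forall>A\<in>?K (Suc i). D \<subseteq> A \<longleftrightarrow> D' \<subseteq> f A)"
    unfolding Bex_def by (rule ballI)
  from bchoice[OF this]
  obtain h where "\<forall>D\<in>?K i. h D \<in> ?K i \<and> (\<forall>A\<in>?K (Suc i). D \<subseteq> A \<longleftrightarrow> h D \<subseteq> f A)"
    by (rule exE)
  then show ?thesis by (intro exI[of _ h] conjI Pi_I ballI) (simp_all only:)
qed

text \<open>A set of at least two points is covered by its subsets with one point less, so the image
  of \<open>A\<close> lies in \<open>A'\<close>, and the sizes agree. This lifts a formula from one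
  layer to the next.\<close>

lemma image_eq_of_subset_images:
  assumes X: "finite X" "inj_on \<sigma> X" and A: "A \<in> ksubsets X (Suc (Suc j))"
    and A': "card A' = Suc (Suc j)" "finite A'"
    and sub: "\<And>D. D \<subseteq> A \<Longrightarrow> card D = Suc j \<Longrightarrow> \<sigma> ` D \<subseteq> A'"
  shows "A' = \<sigma> ` A"
proof (rule sym, rule card_subset_eq)
  have finA: "finite A" using A X by (auto intro: finite_subset)
  show "\<sigma> ` A \<subseteq> A'"
  proof (rule image_subsetI)
    fix x assume x: "x \<in> A"
    have "A \<noteq> {x}" using A by auto
    then obtain y where "y \<in> A" "y \<noteq> x" using x by blast
    then have "\<sigma> ` (A - {y}) \<subseteq> A'" using sub[of "A - {y}"] A finA by auto
    then show "\<sigma> x \<in> A'" using x \<open>y \<noteq> x\<close> by blast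
  qed
  have "inj_on \<sigma> A" using A X by (auto intro: inj_on_subset)
  then show "card (\<sigma> ` A) = card A'" using A A' by (simp add: card_image)
qed (fact A')

text \<open>The pair \<open>(f, g)\<close> descends to \<open>(h, f)\<close> one layer lower, and so
  on to the singletons, where the map is a permutation of points; the formula then climbs back up.
  Counting layers by \<open>Suc j\<close> ends the descent at singletons and not at the empty
  set.\<close>

theorem inclusion_maps_induced:
  assumes X: "finite X"
    and "Suc j + 2 \<le> card X"
    and "f \<in> ksubsets X (Suc j) \<rightarrow> ksubsets X (Suc j)"
    and "g \<in> ksubsets X (Suc (Suc j)) \<rightarrow> ksubsets X (Suc (Suc j))"
    and "\<forall>A\<in>ksubsets X (Suc j). \<forall>B\<in>ksubsets X (Suc (Suc j)). A \<subseteq> B \<longleftrightarrow> f A \<subseteq> g B"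
  shows "\<exists>\<sigma>. bij_betw \<sigma> X X \<and> (\<forall>A\<in>ksubsets X (Suc j). f A = \<sigma> ` A)"
  using assms(2-)
proof (induction j arbitrary: f g)
  case 0
  have bij: "bij_betw f (ksubsets X (Suc 0)) (ksubsets X (Suc 0))"
    using inclusion_maps_bij(1)[OF X _ _ 0(2-4)] 0(1) by simp
  have "\<exists>y\<in>X. f {x} = {y}" if "x \<in> X" for x
    using bij_betwE[OF bij, rule_format, of "{x}"] that by (auto simp: card_Suc_eq)
  then obtain \<sigma> where s: "\<And>x. x \<in> X \<Longrightarrow> \<sigma> x \<in> X \<and> f {x} = {\<sigma> x}" by metis
  have "inj_on \<sigma> X"
  proof (rule inj_onI)
    fix x y assume "x \<in> X" "y \<in> X" "\<sigma> x = \<sigma> y"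
    then have "f {x} = f {y}" using s by simp
    moreover have "{x} \<in> ksubsets X (Suc 0)" "{y} \<in> ksubsets X (Suc 0)"
      using \<open>x \<in> X\<close> \<open>y \<in> X\<close> by auto
    ultimately have "{x} = {y}"
      by (rule inj_onD[OF bij_betw_imp_inj_on[OF bij]])
    then show "x = y" by simp
  qed
  then have "bij_betw \<sigma> X X" using s endo_inj_surj[OF X, of \<sigma>] unfolding bij_betw_def by blast
  moreover have "\<forall>A\<in>ksubsets X (Suc 0). f A = \<sigma> ` A"
    using s by (auto simp: card_Suc_eq)
  ultimately show ?case by blast
next
  case (Suc j)
  from inclusion_maps_descend[OF X Suc.prems]
  obtain h where h1: "h \<in> ksubsets X (Suc j) \<rightarrow> ksubsets X (Suc j)"
    and h2: "\<forall>D\<in>ksubsets X (Suc j). \<forall>A\<in>ksubsets X (Suc (Suc j)). D \<subseteq> A \<longleftrightarrow> h D \<subseteq> f A"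
    by (elim exE conjE)
  have "Suc j + 2 \<le> card X" using Suc.prems(1) by simp
  from Suc.IH[OF this h1 Suc.prems(2) h2]
  obtain \<sigma> where s: "bij_betw \<sigma> X X" "\<forall>D\<in>ksubsets X (Suc j). h D = \<sigma> ` D" by blast
  have "f A = \<sigma> ` A" if A: "A \<in> ksubsets X (Suc (Suc j))" for A
  proof (rule image_eq_of_subset_images[OF X bij_betw_imp_inj_on[OF s(1)] A])
    have fA: "f A \<in> ksubsets X (Suc (Suc j))" using Suc.prems(2) A by blast
    then show "card (f A) = Suc (Suc j)" by simp
    show "finite (f A)" using fA X by (auto intro: finite_subset)
    show "\<sigma> ` D \<subseteq> f A" if "D \<subseteq> A" "card D = Suc j" for D
      using h2[THEN bspec, THEN bspec, of D A] s(2) A that by auto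
  qed
  then show ?case using s(1) by blast
qed

section \<open>The graph \<open>B(n, k)\<close>\<close>

lemma verts_B_graph:
  "verts (B_graph n k) = ksubsets {1..n} k \<union> ksubsets {1..n} (Suc k)"
  by (auto simp: verts_def B_graph_def Let_def)

lemma adj_B_graph:
  "adj (B_graph n k) v w \<longleftrightarrow>
    v \<in> verts (B_graph n k) \<and> w \<in> verts (B_graph n k) \<and> (v \<subset> w \<or> w \<subset> v)"
proof -
  have "edges (B_graph n k) =
    {{v, w} | v w. v \<in> verts (B_graph n k) \<and> w \<in> verts (B_graph n k) \<and> (v \<subset> w \<or> w \<subset> v)}"
    by (simp add: verts_def edges_def B_graph_def Let_def)
  then show ?thesis unfolding adj_def by (auto simp: doubleton_eq_iff)
qed

lemma adj_B_graph_layers: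
  assumes "A \<in> ksubsets {1..n} k" "W \<in> ksubsets {1..n} (Suc k)"
  shows "adj (B_graph n k) A W \<longleftrightarrow> A \<subseteq> W" and "adj (B_graph n k) W A \<longleftrightarrow> A \<subseteq> W"
proof -
  have "finite A" using assms by (auto intro: finite_subset)
  then have "\<not> W \<subset> A" using assms psubset_card_mono[of A W] by auto
  moreover have "A \<noteq> W" using assms by auto
  ultimately show "adj (B_graph n k) A W \<longleftrightarrow> A \<subseteq> W" "adj (B_graph n k) W A \<longleftrightarrow> A \<subseteq> W"
    using assms by (auto simp: adj_B_graph verts_B_graph)
qed

section \<open>Edges, degrees and connectedness of the graph\<close>

lemma finite_verts_B_graph: "finite (verts (B_graph n k))"
  unfolding verts_B_graph by (rule finite_subset[of _ "Pow {1..n}"]) auto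

text \<open>Coordinates for edges, used to count them and to choose representatives. Strict
  inclusion between two vertices forces the sizes \<open>k\<close> and \<open>k + 1\<close>, hence a
  single added point.\<close>

lemma edges_B_graph:
  "edges (B_graph n k) =
    (\<lambda>(A, x). {A, insert x A}) ` (SIGMA A:ksubsets {1..n} k. {1..n} - A)"
  (is "_ = ?R")
proof (intro subset_antisym subsetI)
  fix e assume "e \<in> edges (B_graph n k)"
  then obtain v w where e: "e = {v, w}"
    and vw: "v \<in> verts (B_graph n k)" "w \<in> verts (B_graph n k)" "v \<subset> w"
    by (auto simp: verts_def edges_def B_graph_def Let_def)
  have fin: "finite v" "finite w" using vw by (auto simp: verts_B_graph intro: finite_subset)
  have "card v < card w" using vw fin by (simp add: psubset_card_mono)
  then have K: "v \<in> ksubsets {1..n} k" "w \<in> ksubsets {1..n} (Suc k)"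
    using vw by (auto simp: verts_B_graph)
  have "card (w - v) = 1" using K fin vw(3) by (simp add: card_Diff_subset)
  then obtain x where x: "w - v = {x}" by (auto simp: card_1_singleton_iff)
  then have "w = insert x v" "x \<in> {1..n} - v" using vw(3) K by auto
  then show "e \<in> ?R" using e K by (intro image_eqI[of _ _ "(v, x)"]) auto
next
  fix e assume "e \<in> ?R"
  then obtain A x where e: "e = {A, insert x A}" "A \<in> ksubsets {1..n} k" "x \<in> {1..n} - A" by auto
  have "finite A" using e by (auto intro: finite_subset)
  then have "insert x A \<in> ksubsets {1..n} (Suc k)" using e by auto
  then have "adj (B_graph n k) A (insert x A)" using adj_B_graph_layers(1)[OF e(2)] by blast
  then show "e \<in> edges (B_graph n k)" using e by (simp add: adj_def)
qed

lemma edge_B_graphE: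
  assumes "e \<in> edges (B_graph n k)"
  obtains A x where "e = {A, insert x A}" "A \<in> ksubsets {1..n} k" "x \<in> {1..n} - A"
    "insert x A \<in> ksubsets {1..n} (Suc k)"
proof -
  obtain A x where e: "e = {A, insert x A}" "A \<in> ksubsets {1..n} k" "x \<in> {1..n} - A"
    using assms unfolding edges_B_graph by auto
  then have "finite A" by (auto intro: finite_subset)
  with e show thesis by (intro that[of A x]) auto
qed

lemma edge_B_graphI:
  assumes "A \<in> ksubsets {1..n} k" "x \<in> {1..n} - A"
  shows "{A, insert x A} \<in> edges (B_graph n k)"
  unfolding edges_B_graph using assms by (intro image_eqI[of _ _ "(A, x)"]) auto

lemma simple_B_graph:
  assumes "e \<in> edges (B_graph n k)"
  shows "e \<subseteq> verts (B_graph n k) \<and> card e = 2"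
  using assms by (elim edge_B_graphE) (auto simp: verts_B_graph card_2_iff)

lemma card_edges_B_graph: "card (edges (B_graph n k)) = (n choose k) * (n - k)"
proof -
  let ?S = "SIGMA A:ksubsets {1..n} k. {1..n} - A"
  have "inj_on (\<lambda>(A, x). {A, insert x A}) ?S"
    by (auto simp: inj_on_def doubleton_eq_iff)
  then have "card (edges (B_graph n k)) = card ?S"
    unfolding edges_B_graph by (rule card_image)
  also have "\<dots> = (\<Sum>A\<in>ksubsets {1..n} k. card ({1..n} - A))"
    by (rule card_SigmaI) auto
  also have "\<dots> = (\<Sum>A\<in>ksubsets {1..n} k. n - k)"
    by (rule sum.cong) (auto simp: card_Diff_subset finite_subset[OF _ finite_atLeastAtMost])
  also have "\<dots> = (n choose k) * (n - k)"
    using n_subsets[of "{1..n}" k] by simp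
  finally show ?thesis .
qed

lemma vert_B_graphD:
  assumes "v \<in> verts (B_graph n k)"
  shows "v \<subseteq> {1..n}" "finite v" "card v = k \<or> card v = Suc k"
  using assms by (auto simp: verts_B_graph intro: finite_subset)

lemma adj_B_graph_card_neq:
  assumes "adj (B_graph n k) v w"
  shows "card v \<noteq> card w"
proof -
  have "finite v" "finite w" using assms vert_B_graphD(2) by (auto simp: adj_B_graph)
  moreover have "v \<subset> w \<or> w \<subset> v" using assms by (simp add: adj_B_graph)
  ultimately show ?thesis by (metis less_irrefl psubset_card_mono)
qed

lemma triangle_free_B_graph:
  assumes "adj (B_graph n k) a b" "adj (B_graph n k) b c"
  shows "\<not> adj (B_graph n k) a c"
proof
  assume ac: "adj (B_graph n k) a c"
  have "a \<in> verts (B_graph n k)" "b \<in> verts (B_graph n k)" "c \<in> verts (B_graph n k)"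
    using assms by (auto simp: adj_B_graph)
  then show False
    using assms[THEN adj_B_graph_card_neq] ac[THEN adj_B_graph_card_neq] vert_B_graphD(3)[of _ n k]
    by metis
qed

text \<open>Adding a point to a lower vertex gives \<open>n - k\<close> neighbours, removing one
  from an upper vertex gives \<open>k + 1\<close>.\<close>

lemma degree_B_graph:
  assumes "v \<in> verts (B_graph n k)" "k \<ge> 2" "k + 3 \<le> n"
  shows "card {w. adj (B_graph n k) v w} \<ge> 3"
proof -
  have fin: "finite {w. adj (B_graph n k) v w}"
    by (rule finite_subset[OF _ finite_verts_B_graph[of n k]]) (auto simp: adj_B_graph)
  have finv: "finite v" using assms by (auto simp: verts_B_graph intro: finite_subset)
  consider "v \<in> ksubsets {1..n} k" | "v \<in> ksubsets {1..n} (Suc k)"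
    using assms(1) unfolding verts_B_graph by blast
  then show ?thesis
  proof cases
    case 1
    have "insert x v \<in> {w. adj (B_graph n k) v w}" if "x \<in> {1..n} - v" for x
    proof -
      have "insert x v \<in> ksubsets {1..n} (Suc k)" using 1 that finv by auto
      then show ?thesis using adj_B_graph_layers(1)[OF 1] by blast
    qed
    then have "card ((\<lambda>x. insert x v) ` ({1..n} - v)) \<le> card {w. adj (B_graph n k) v w}"
      by (intro card_mono[OF fin] image_subsetI)
    moreover have "inj_on (\<lambda>x. insert x v) ({1..n} - v)" by (auto simp: inj_on_def)
    moreover have "card ({1..n} - v) = n - k" using 1 finv by (simp add: card_Diff_subset)
    ultimately show ?thesis using assms(3) by (simp add: card_image)
  next
    case 2
    have "v - {x} \<in> {w. adj (B_graph n k) v w}" if "x \<in> v" for x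
    proof -
      have "v - {x} \<in> ksubsets {1..n} k" using 2 that finv by auto
      then show ?thesis using adj_B_graph_layers(2)[OF _ 2] by blast
    qed
    then have "card ((\<lambda>x. v - {x}) ` v) \<le> card {w. adj (B_graph n k) v w}"
      by (intro card_mono[OF fin] image_subsetI)
    moreover have "inj_on (\<lambda>x. v - {x}) v" by (auto simp: inj_on_def)
    ultimately show ?thesis using assms(2) 2 by (simp add: card_image)
  qed
qed

text \<open>Connectedness, phrased for predicates instead of paths. One \<open>k\<close>-set is
  turned into another by exchanging a point at a time, each exchange passing through a common upper
  neighbour; an upper vertex is first moved down.\<close>

lemma adj_invariant_B_graph:
  assumes inv: "\<And>v w. adj (B_graph n k) v w \<Longrightarrow> P v \<longleftrightarrow> P w"
    and "v \<in> verts (B_graph n k)" "w \<in> verts (B_graph n k)"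
  shows "P v \<longleftrightarrow> P w"
proof -
  have low: "P A \<longleftrightarrow> P A'" if "A \<in> ksubsets {1..n} k" "A' \<in> ksubsets {1..n} k" for A A'
    using that
  proof (induction "card (A - A')" arbitrary: A)
    case 0
    have fin: "finite A" "finite A'" using 0 by (auto intro: finite_subset)
    then have "A \<subseteq> A'" using 0 by simp
    then have "A = A'" using 0 fin by (intro card_subset_eq) auto
    then show ?case by simp
  next
    case (Suc m)
    have fin: "finite A" "finite A'" using Suc.prems by (auto intro: finite_subset)
    have "card (A - A') \<noteq> 0" using Suc.hyps(2) by simp
    then have "A - A' \<noteq> {}" by (metis card.empty)
    then obtain a where a: "a \<in> A" "a \<notin> A'" by blast
    have "\<not> A' \<subseteq> A" using card_subset_eq[of A A'] fin Suc.prems a by auto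
    then obtain b where b: "b \<in> A'" "b \<notin> A" by blast
    let ?W = "insert b A" and ?A = "insert b A - {a}"
    have W: "?W \<in> ksubsets {1..n} (Suc k)" and A: "?A \<in> ksubsets {1..n} k"
      using Suc.prems fin a b by auto
    have "P A \<longleftrightarrow> P ?W" using inv adj_B_graph_layers(1)[OF Suc.prems(1) W] by blast
    moreover have "P ?A \<longleftrightarrow> P ?W" using inv adj_B_graph_layers(1)[OF A W] by blast
    moreover have "?A - A' = (A - A') - {a}" using b by auto
    then have "card (?A - A') = m" using Suc.hyps(2) a fin by simp
    then have "P ?A \<longleftrightarrow> P A'" using Suc.hyps(1)[OF _ A Suc.prems(2)] by simp
    ultimately show ?case by blast
  qed
  have red: "\<exists>A\<in>ksubsets {1..n} k. P u \<longleftrightarrow> P A" if "u \<in> verts (B_graph n k)" for u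
  proof (cases "card u = k")
    case True
    then show ?thesis using that by (auto simp: verts_B_graph)
  next
    case False
    then have u: "u \<in> ksubsets {1..n} (Suc k)" using that by (auto simp: verts_B_graph)
    then have "finite u" "u \<noteq> {}" by (auto intro: finite_subset)
    then obtain x where "x \<in> u" by blast
    then have A: "u - {x} \<in> ksubsets {1..n} k" using u \<open>finite u\<close> by auto
    have "P (u - {x}) \<longleftrightarrow> P u" using inv adj_B_graph_layers(1)[OF A u] by blast
    then show ?thesis using A by (intro bexI[of _ "u - {x}"]) simp_all
  qed
  show ?thesis using low red[OF assms(2)] red[OF assms(3)] by blast
qed

section \<open>Automorphisms of the graph and of its line graph\<close>

lemma graph_iso_perm_B_graph:
  assumes "bij_betw \<sigma> {1..n} {1..n}"
  shows "graph_iso ((`) \<sigma>) (B_graph n k) (B_graph n k)"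
proof -
  have inj: "inj_on \<sigma> {1..n}" using assms by (rule bij_betw_imp_inj_on)
  have sub: "v \<subseteq> {1..n}" if "v \<in> verts (B_graph n k)" for v using that by (auto simp: verts_B_graph)
  have le: "(\<sigma> ` v \<subseteq> \<sigma> ` w) = (v \<subseteq> w)" if "v \<subseteq> {1..n}" "w \<subseteq> {1..n}" for v w
    using inj_on_image_mem_iff[OF inj _ that(2)] that(1) by blast
  have mem: "\<sigma> ` v \<in> verts (B_graph n k)" if "v \<in> verts (B_graph n k)" for v
  proof -
    have "card (\<sigma> ` v) = card v" using inj_on_subset[OF inj sub[OF that]] by (rule card_image)
    moreover have "\<sigma> ` v \<subseteq> {1..n}" using sub[OF that] assms unfolding bij_betw_def by blast
    ultimately show ?thesis using that by (auto simp: verts_B_graph)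
  qed
  have "inj_on ((`) \<sigma>) (verts (B_graph n k))"
    using inj sub by (metis inj_onI inj_on_image_eq_iff)
  then have "bij_betw ((`) \<sigma>) (verts (B_graph n k)) (verts (B_graph n k))"
    using mem endo_inj_surj[OF finite_verts_B_graph] unfolding bij_betw_def by blast
  moreover have "(\<sigma> ` v \<subset> \<sigma> ` w) = (v \<subset> w)"
    if "v \<in> verts (B_graph n k)" "w \<in> verts (B_graph n k)" for v w
    unfolding less_le_not_le using le[OF sub sub] that by blast
  ultimately show ?thesis using mem unfolding graph_iso_def adj_B_graph by auto
qed

text \<open>On the two layers \<open>\<psi>\<close> is a pair of maps preserving and reflecting
  inclusion, which yields \<open>\<sigma>\<close> on the lower layer. An upper vertex is then
  determined by its \<open>k\<close>-subsets.\<close>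

lemma graph_iso_layer_preserving_B_graph:
  assumes k: "k > 0" "k + 2 \<le> n"
    and psi: "graph_iso \<psi> (B_graph n k) (B_graph n k)"
    and card: "\<And>v. v \<in> verts (B_graph n k) \<Longrightarrow> card (\<psi> v) = card v"
  shows "\<exists>\<sigma>. bij_betw \<sigma> {1..n} {1..n} \<and> (\<forall>v\<in>verts (B_graph n k). \<psi> v = \<sigma> ` v)"
proof -
  obtain j where j: "k = Suc j" using k by (cases k) auto
  let ?X = "{1..n}"
  have mem: "\<psi> v \<in> verts (B_graph n k)" if "v \<in> verts (B_graph n k)" for v
    using psi that unfolding graph_iso_def bij_betw_def by blast
  have K1: "\<psi> A \<in> ksubsets ?X k" if "A \<in> ksubsets ?X k" for A
    using mem[of A] card[of A] that by (auto simp: verts_B_graph)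
  have K2: "\<psi> A \<in> ksubsets ?X (Suc k)" if "A \<in> ksubsets ?X (Suc k)" for A
    using mem[of A] card[of A] that by (auto simp: verts_B_graph)
  have incl: "A \<subseteq> W \<longleftrightarrow> \<psi> A \<subseteq> \<psi> W" if A: "A \<in> ksubsets ?X k" "W \<in> ksubsets ?X (Suc k)" for A W
  proof -
    have "A \<in> verts (B_graph n k)" "W \<in> verts (B_graph n k)" using A by (auto simp: verts_B_graph)
    then have "adj (B_graph n k) A W \<longleftrightarrow> adj (B_graph n k) (\<psi> A) (\<psi> W)"
      using psi unfolding graph_iso_def by blast
    then show ?thesis using adj_B_graph_layers(1)[OF A] adj_B_graph_layers(1)[OF K1[OF A(1)] K2[OF A(2)]]
      by simp
  qed
  have "\<exists>\<sigma>. bij_betw \<sigma> ?X ?X \<and> (\<forall>A\<in>ksubsets ?X (Suc j). \<psi> A = \<sigma> ` A)"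
  proof (rule inclusion_maps_induced)
    show "\<psi> \<in> ksubsets ?X (Suc j) \<rightarrow> ksubsets ?X (Suc j)"
      "\<psi> \<in> ksubsets ?X (Suc (Suc j)) \<rightarrow> ksubsets ?X (Suc (Suc j))"
      using K1 K2 unfolding j by (intro Pi_I; simp only:)+
    show "\<forall>A\<in>ksubsets ?X (Suc j). \<forall>B\<in>ksubsets ?X (Suc (Suc j)). A \<subseteq> B \<longleftrightarrow> \<psi> A \<subseteq> \<psi> B"
      using incl unfolding j by (intro ballI)
  qed (use k j in auto)
  then obtain \<sigma> where s: "bij_betw \<sigma> ?X ?X" "\<forall>A\<in>ksubsets ?X k. \<psi> A = \<sigma> ` A"
    unfolding j by (elim exE conjE)
  have "\<psi> W = \<sigma> ` W" if W: "W \<in> ksubsets ?X (Suc k)" for W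
  proof (rule image_eq_of_subset_images[OF _ bij_betw_imp_inj_on[OF s(1)] W[unfolded j]])
    show "card (\<psi> W) = Suc (Suc j)" using K2[OF W] j by simp
    show "finite (\<psi> W)" using K2[OF W] by (auto intro: finite_subset)
    fix D assume D: "D \<subseteq> W" "card D = Suc j"
    have DK: "D \<in> ksubsets ?X k" using D W j by auto
    have "\<psi> D \<subseteq> \<psi> W" using incl[OF DK W] D(1) by (rule iffD1)
    then show "\<sigma> ` D \<subseteq> \<psi> W" unfolding bspec[OF s(2) DK] .
  qed simp
  then have "\<forall>v\<in>verts (B_graph n k). \<psi> v = \<sigma> ` v"
    unfolding verts_B_graph ball_Un by (intro conjI[OF s(2)] ballI)
  then show ?thesis using s(1) by (intro exI conjI)
qed

text \<open>With \<open>2 * k + 1\<close> points, complementation swaps the sizes \<open>k\<close>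
  and \<open>k + 1\<close>. It reverses inclusion, but adjacency is symmetric.\<close>

lemma graph_iso_complement_B_graph:
  "graph_iso (\<lambda>v. {1..2 * k + 1} - v) (B_graph (2 * k + 1) k) (B_graph (2 * k + 1) k)"
proof -
  let ?X = "{1..2 * k + 1}" and ?V = "verts (B_graph (2 * k + 1) k)"
  have mem: "?X - v \<in> ?V" if "v \<in> ?V" for v
  proof -
    have "v \<subseteq> ?X" using that by (auto simp: verts_B_graph)
    moreover from this have "finite v" by (rule finite_subset) simp
    ultimately have "card (?X - v) = 2 * k + 1 - card v" by (simp add: card_Diff_subset)
    then show ?thesis using that by (auto simp: verts_B_graph)
  qed
  have inv: "?X - (?X - v) = v" if "v \<in> ?V" for v using that by (auto simp: verts_B_graph)
  have "bij_betw (\<lambda>v. ?X - v) ?V ?V"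
    by (rule bij_betw_byWitness[where f' = "\<lambda>v. ?X - v"]) (use mem inv in blast)+
  moreover have "(?X - v \<subset> ?X - w) = (w \<subset> v)" if "v \<in> ?V" "w \<in> ?V" for v w
    using inv[OF that(1)] inv[OF that(2)] by blast
  ultimately show ?thesis using mem unfolding graph_iso_def adj_B_graph by auto
qed

lemma graph_iso_comp:
  assumes "graph_iso f G H" "graph_iso g H K"
  shows "graph_iso (g \<circ> f) G K"
proof -
  have "f x \<in> verts H" if "x \<in> verts G" for x
    using assms(1) that unfolding graph_iso_def bij_betw_def by blast
  then show ?thesis
    using assms bij_betw_trans[of f "verts G" "verts H" g "verts K"] unfolding graph_iso_def by simp
qed

theorem automorphisms_middle_layers:
  assumes k: "k > 0"
    and psi: "graph_iso \<psi> (B_graph (2 * k + 1) k) (B_graph (2 * k + 1) k)"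
  shows "\<exists>\<sigma>. bij_betw \<sigma> {1..2 * k + 1} {1..2 * k + 1} \<and>
    ((\<forall>v\<in>verts (B_graph (2 * k + 1) k). \<psi> v = \<sigma> ` v) \<or>
     (\<forall>v\<in>verts (B_graph (2 * k + 1) k). \<psi> v = {1..2 * k + 1} - \<sigma> ` v))"
proof -
  let ?n = "2 * k + 1"
  let ?X = "{1..?n}" and ?G = "B_graph ?n k"
  have mem: "\<psi> v \<in> verts ?G" if "v \<in> verts ?G" for v
    using psi that unfolding graph_iso_def bij_betw_def by blast
  have cardV: "card v = k \<or> card v = Suc k" if "v \<in> verts ?G" for v
    using that by (rule vert_B_graphD(3))
  \<comment> \<open>Only two sizes occur, and the ends of an edge differ in size both before and
    after \<open>\<psi>\<close>; so both ends keep their layer or both change it.\<close>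
  have step: "card (\<psi> v) = card v \<longleftrightarrow> card (\<psi> w) = card w" if "adj ?G v w" for v w
  proof -
    have V: "v \<in> verts ?G" "w \<in> verts ?G" using that by (auto simp: adj_B_graph)
    then have "adj ?G (\<psi> v) (\<psi> w)" using psi that unfolding graph_iso_def by blast
    from adj_B_graph_card_neq[OF this] adj_B_graph_card_neq[OF that] show ?thesis
      using cardV[OF V(1)] cardV[OF V(2)] cardV[OF mem[OF V(1)]] cardV[OF mem[OF V(2)]] by presburger
  qed
  have const: "card (\<psi> v) = card v \<longleftrightarrow> card (\<psi> w) = card w"
    if "v \<in> verts ?G" "w \<in> verts ?G" for v w
    by (rule adj_invariant_B_graph[of ?n k "\<lambda>v. card (\<psi> v) = card v", OF _ that])
      (rule step)
  have le: "k + 2 \<le> ?n" using k by simp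
  show ?thesis
  proof (cases "\<forall>v\<in>verts ?G. card (\<psi> v) = card v")
    case True
    then show ?thesis
      using graph_iso_layer_preserving_B_graph[OF k le psi] by blast
  next
    case nonpres: False
    let ?\<psi>' = "(\<lambda>v. ?X - v) \<circ> \<psi>"
    have "graph_iso ?\<psi>' ?G ?G" by (rule graph_iso_comp[OF psi graph_iso_complement_B_graph])
    moreover have "card (?\<psi>' v) = card v" if v: "v \<in> verts ?G" for v
    proof -
      have "\<psi> v \<subseteq> ?X" using mem[OF v] by (auto simp: verts_B_graph)
      moreover from this have "finite (\<psi> v)" by (rule finite_subset) simp
      ultimately have "card (?\<psi>' v) = 2 * k + 1 - card (\<psi> v)" by (simp add: card_Diff_subset)
      moreover have "card (\<psi> v) \<noteq> card v" using nonpres const v by blast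
      ultimately show ?thesis using cardV[OF v] cardV[OF mem[OF v]] by auto
    qed
    ultimately obtain \<sigma> where s: "bij_betw \<sigma> ?X ?X" "\<forall>v\<in>verts ?G. ?\<psi>' v = \<sigma> ` v"
      using graph_iso_layer_preserving_B_graph[OF k le] by blast
    have "\<psi> v = ?X - \<sigma> ` v" if v: "v \<in> verts ?G" for v
    proof -
      have "\<psi> v \<subseteq> ?X" using mem[OF v] by (auto simp: verts_B_graph)
      moreover have "?X - \<psi> v = \<sigma> ` v" using s(2) v by simp
      ultimately show ?thesis by blast
    qed
    then show ?thesis using s(1) by blast
  qed
qed

theorem automorphisms_line_graph_middle_layers:
  assumes k: "k \<ge> 2"
    and phi: "graph_iso \<phi> (line_graph (B_graph (2 * k + 1) k)) (line_graph (B_graph (2 * k + 1) k))"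
  shows "\<exists>\<sigma>. bij_betw \<sigma> {1..2 * k + 1} {1..2 * k + 1} \<and>
    ((\<forall>e\<in>edges (B_graph (2 * k + 1) k). \<phi> e = (\<lambda>v. \<sigma> ` v) ` e) \<or>
     (\<forall>e\<in>edges (B_graph (2 * k + 1) k). \<phi> e = (\<lambda>v. {1..2 * k + 1} - \<sigma> ` v) ` e))"
proof -
  let ?G = "B_graph (2 * k + 1) k" and ?X = "{1..2 * k + 1}"
  have "\<exists>\<psi>. graph_iso \<psi> ?G ?G \<and> (\<forall>e\<in>edges ?G. \<phi> e = \<psi> ` e)"
  proof (rule line_graph_automorphism_induced[OF finite_verts_B_graph _ _ _ phi])
    show "e \<subseteq> verts ?G \<and> card e = 2" if "e \<in> edges ?G" for e
      using that by (rule simple_B_graph)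
    show "\<not> adj ?G a c" if "adj ?G a b" "adj ?G b c" for a b c
      using that by (rule triangle_free_B_graph)
    show "card {w. adj ?G v w} \<ge> 3" if "v \<in> verts ?G" for v
      using that k by (intro degree_B_graph) auto
  qed
  then obtain \<psi> where psi: "graph_iso \<psi> ?G ?G" "\<forall>e\<in>edges ?G. \<phi> e = \<psi> ` e"
    by (elim exE conjE)
  have "k > 0" using k by simp
  from automorphisms_middle_layers[OF this psi(1)]
  obtain \<sigma> where s: "bij_betw \<sigma> ?X ?X"
    "(\<forall>v\<in>verts ?G. \<psi> v = \<sigma> ` v) \<or> (\<forall>v\<in>verts ?G. \<psi> v = ?X - \<sigma> ` v)"
    by (elim exE conjE)
  have img: "\<forall>e\<in>edges ?G. \<phi> e = f ` e" if "\<forall>v\<in>verts ?G. \<psi> v = f v" for f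
  proof
    fix e assume e: "e \<in> edges ?G"
    have "\<phi> e = \<psi> ` e" using psi(2) e by (rule bspec)
    also have "\<dots> = f ` e"
      using simple_B_graph[OF e] that by (intro image_cong) auto
    finally show "\<phi> e = f ` e" .
  qed
  from s(2) have "(\<forall>e\<in>edges ?G. \<phi> e = (\<lambda>v. \<sigma> ` v) ` e) \<or> (\<forall>e\<in>edges ?G. \<phi> e = (\<lambda>v. ?X - \<sigma> ` v) ` e)"
    by (rule disj_forward) (erule img)+
  then show ?thesis by (intro exI[of _ \<sigma>] conjI[OF s(1)])
qed

section \<open>Transitivity and fixed edges\<close>

text \<open>An edge splits the points into \<open>A\<close>, the added point \<open>x\<close> and
  the rest. Bijections between corresponding blocks of two edges glue to a permutation of the
  points.\<close>

lemma vertex_transitive_line_graph_B_graph: "vertex_transitive (line_graph (B_graph n k))"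
  unfolding vertex_transitive_def verts_line_graph
proof (intro ballI)
  fix e e' assume E: "e \<in> edges (B_graph n k)" "e' \<in> edges (B_graph n k)"
  obtain A x where e: "e = {A, insert x A}" "A \<in> ksubsets {1..n} k" "x \<in> {1..n} - A"
    "insert x A \<in> ksubsets {1..n} (Suc k)"
    using E(1) by (rule edge_B_graphE)
  obtain A' x' where e': "e' = {A', insert x' A'}" "A' \<in> ksubsets {1..n} k" "x' \<in> {1..n} - A'"
    "insert x' A' \<in> ksubsets {1..n} (Suc k)"
    using E(2) by (rule edge_B_graphE)
  have fin: "finite A" "finite A'" using e e' by (auto intro: finite_subset)
  let ?R = "{1..n} - insert x A" and ?R' = "{1..n} - insert x' A'"
  have "card A = card A'" using e e' by simp
  then obtain f where f: "bij_betw f A A'" using fin finite_same_card_bij by blast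
  have "card ?R = n - Suc k" "card ?R' = n - Suc k"
    using e e' fin by (auto simp: card_Diff_subset)
  then obtain g where g: "bij_betw g ?R ?R'" using finite_same_card_bij[of ?R ?R'] by auto
  define \<sigma> where "\<sigma> y = (if y \<in> A then f y else if y = x then x' else g y)" for y
  have A: "bij_betw \<sigma> A A'"
    using f by (subst bij_betw_cong[of _ _ f]) (auto simp: \<sigma>_def)
  have "bij_betw \<sigma> {x} {x'}" using e by (auto simp: \<sigma>_def)
  moreover have "bij_betw \<sigma> ?R ?R'"
    using g by (subst bij_betw_cong[of _ _ g]) (auto simp: \<sigma>_def)
  ultimately have "bij_betw \<sigma> (A \<union> ({x} \<union> ?R)) (A' \<union> ({x'} \<union> ?R'))"
    using A e' by (intro bij_betw_combine) auto
  moreover have "A \<union> ({x} \<union> ?R) = {1..n}" "A' \<union> ({x'} \<union> ?R') = {1..n}" using e e' by auto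
  ultimately have "bij_betw \<sigma> {1..n} {1..n}" by simp
  then have "graph_iso ((`) ((`) \<sigma>)) (line_graph (B_graph n k)) (line_graph (B_graph n k))"
    by (intro line_graph_automorphism_image graph_iso_perm_B_graph simple_B_graph)
  moreover have "\<sigma> ` A = A'" "\<sigma> x = x'"
    using A e(3) by (simp_all add: bij_betw_def) (simp add: \<sigma>_def)
  then have "((`) ((`) \<sigma>)) e = e'"
    unfolding e(1) e'(1) by simp
  ultimately show "\<exists>\<phi>. graph_iso \<phi> (line_graph (B_graph n k)) (line_graph (B_graph n k)) \<and> \<phi> e = e'"
    by blast
qed

lemma involution_fixes_edge:
  assumes "even k" "\<sigma> ` {1..2 * k + 1} \<subseteq> {1..2 * k + 1}"
    and inv: "\<And>x. x \<in> {1..2 * k + 1} \<Longrightarrow> \<sigma> (\<sigma> x) = x"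
  shows "\<exists>e\<in>edges (B_graph (2 * k + 1) k). (\<lambda>v. \<sigma> ` v) ` e = e"
proof -
  let ?X = "{1..2 * k + 1}"
  have mem: "\<sigma> x \<in> ?X" if "x \<in> ?X" for x using assms(2) that by blast
  \<comment> \<open>All points but one are collected first: the point \<open>x\<close> left over
    must be fixed. Then \<open>A\<close> is taken inside \<open>S\<close>, so it avoids
    \<open>x\<close>; its size has to be even, which is where the parity of \<open>k\<close>
    enters.\<close>
  have "\<exists>S\<subseteq>?X. card S = 2 * k \<and> \<sigma> ` S = S"
    by (rule invariant_subset_of_even_card[OF _ mem inv]) simp_all
  then obtain S where S: "S \<subseteq> ?X" "card S = 2 * k" "\<sigma> ` S = S" by (elim exE conjE)
  obtain j where j: "k = 2 * j" using assms(1) by blast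
  have finS: "finite S" using S(1) by (rule finite_subset) simp
  have "\<exists>A\<subseteq>S. card A = 2 * j \<and> \<sigma> ` A = A"
    by (rule invariant_subset_of_even_card) (use finS S inv j in auto)
  then obtain A where A: "A \<subseteq> S" "card A = k" "\<sigma> ` A = A" using j by auto
  have "card (?X - S) = 1" using S finS by (simp add: card_Diff_subset)
  then obtain x where x: "?X - S = {x}" by (auto simp: card_1_singleton_iff)
  have "x \<in> ?X" "x \<notin> S" using x by auto
  then have "\<sigma> x \<in> ?X" using assms(2) by blast
  moreover have "\<sigma> x \<notin> S" using S(3) inv[OF \<open>x \<in> ?X\<close>] \<open>x \<notin> S\<close> by (metis imageI)
  ultimately have "\<sigma> x = x" using x by blast
  then have "(\<lambda>v. \<sigma> ` v) ` {A, insert x A} = {A, insert x A}" using A(3) by simp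
  moreover have "{A, insert x A} \<in> edges (B_graph (2 * k + 1) k)"
    using A S(1) x by (intro edge_B_graphI) auto
  ultimately show ?thesis by blast
qed

text \<open>The ends of an edge differ in size, so the square of \<open>\<sigma>\<close> cannot swap
  them and fixes both. A point moved by the square would be separated from its image by some
  \<open>k\<close>-set, the lower end of an edge.\<close>

lemma involution_if_edge_involution:
  assumes k: "0 < k" "k < n" and s: "bij_betw \<sigma> {1..n} {1..n}"
    and inv: "\<And>e. e \<in> edges (B_graph n k) \<Longrightarrow> (\<lambda>v. \<sigma> ` v) ` (\<lambda>v. \<sigma> ` v) ` e = e"
    and x: "x \<in> {1..n}"
  shows "\<sigma> (\<sigma> x) = x"
proof (rule ccontr)
  assume ne: "\<sigma> (\<sigma> x) \<noteq> x"
  let ?\<tau> = "\<sigma> \<circ> \<sigma>"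
  have t: "bij_betw ?\<tau> {1..n} {1..n}" using s by (rule bij_betw_trans[OF s])
  have "card ({1..n} - {x, \<sigma> (\<sigma> x)}) \<ge> k - 1"
  proof -
    have "\<sigma> (\<sigma> x) \<in> {1..n}" using t x by (auto simp: bij_betw_def)
    then show ?thesis using x ne k by (simp add: card_Diff_subset)
  qed
  then obtain T where T: "T \<subseteq> {1..n} - {x, \<sigma> (\<sigma> x)}" "card T = k - 1" "finite T"
    by (meson obtain_subset_with_card_n)
  let ?A = "insert x T"
  have "x \<notin> T" using T(1) by blast
  then have "card ?A = k" using T k by simp
  then have A: "?A \<in> ksubsets {1..n} k" using T(1) x by blast
  have "\<not> {1..n} \<subseteq> ?A" using card_mono[of ?A "{1..n}"] A T(3) k by auto
  then obtain y where y: "y \<in> {1..n} - ?A" by blast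
  have E: "{?A, insert y ?A} \<in> edges (B_graph n k)" using A y by (rule edge_B_graphI)
  have "{?\<tau> ` ?A, ?\<tau> ` insert y ?A} = {?A, insert y ?A}"
    using inv[OF E] by (simp add: image_comp)
  moreover have "card (?\<tau> ` ?A) = k"
    using A card_image[OF inj_on_subset[OF bij_betw_imp_inj_on[OF t], of ?A]] by auto
  moreover have "card (insert y ?A) = Suc k" using A T(3) y by auto
  ultimately have "?\<tau> ` ?A = ?A" by (auto simp: doubleton_eq_iff)
  then have "?\<tau> x \<in> ?A" by blast
  then show False using ne T by auto
qed

section \<open>The action of a Cayley group on the edges\<close>

lemma (in group) graph_iso_cayley_left_mult:
  assumes "g \<in> carrier G"
  shows "graph_iso (\<lambda>h. g \<otimes> h) (cayley_graph G \<Omega>) (cayley_graph G \<Omega>)"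
proof -
  \<comment> \<open>Edges are unordered, so either order of the endpoints may witness
    adjacency.\<close>
  have adj: "adj (cayley_graph G \<Omega>) x y \<longleftrightarrow> x \<in> carrier G \<and> y \<in> carrier G \<and> (inv x \<otimes> y \<in> \<Omega> \<or> inv y \<otimes> x \<in> \<Omega>)"
    for x y
    unfolding adj_def cayley_graph_def edges_def by (auto simp: doubleton_eq_iff)
  have *: "inv (g \<otimes> x) \<otimes> (g \<otimes> y) = inv x \<otimes> y" if "x \<in> carrier G" "y \<in> carrier G" for x y
    using that assms by (simp add: inv_mult_group m_assoc) (simp add: m_assoc[symmetric])
  have "bij_betw (\<lambda>h. g \<otimes> h) (carrier G) (carrier G)"
    using assms by (intro bij_betw_byWitness[where f' = "\<lambda>h. inv g \<otimes> h"]) (auto simp: m_assoc[symmetric])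
  moreover have "verts (cayley_graph G \<Omega>) = carrier G" by (simp add: verts_def cayley_graph_def)
  ultimately show ?thesis using assms * unfolding graph_iso_def adj by auto
qed

lemma graph_iso_inv_into:
  assumes "graph_iso f G H"
  shows "graph_iso (inv_into (verts G) f) H G"
proof -
  have bij: "bij_betw f (verts G) (verts H)" using assms by (simp add: graph_iso_def)
  have "adj H x y \<longleftrightarrow> adj G (inv_into (verts G) f x) (inv_into (verts G) f y)"
    if "x \<in> verts H" "y \<in> verts H" for x y
    using assms that bij_betwE[OF bij_betw_inv_into[OF bij]] bij_betw_inv_into_right[OF bij]
    unfolding graph_iso_def by simp
  then show ?thesis using bij_betw_inv_into[OF bij] unfolding graph_iso_def by blast
qed

text \<open>Left multiplication carried over by \<open>f\<close> acts freely on the edges, whereas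
  an involution acting through points fixes an edge. The number of edges forces such an involution
  to exist.\<close>

lemma (in group) not_cayley_line_graph_middle_layers:
  assumes k: "even k" "k \<ge> 2" and dvd: "4 dvd (2 * k choose k)"
    and iso: "graph_iso f (cayley_graph G \<Omega>) (line_graph (B_graph (2 * k + 1) k))"
  shows False
proof -
  let ?B = "B_graph (2 * k + 1) k" and ?X = "{1..2 * k + 1}" and ?C = "cayley_graph G \<Omega>"
  let ?E = "edges ?B"
  have C: "verts ?C = carrier G" by (simp add: verts_def cayley_graph_def)
  have bij: "bij_betw f (carrier G) ?E" using iso by (simp add: graph_iso_def C verts_line_graph)
  \<comment> \<open>Symmetry and absorption rewrite the count
    \<open>(k + 1) * (2 * k + 1 choose k)\<close> so that the central coefficient becomes a
    factor.\<close>
  have cardE: "card ?E = (2 * k + 1) * (2 * k choose k)"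
  proof -
    have "card ?E = Suc k * (Suc (2 * k) choose k)"
      by (simp only: card_edges_B_graph mult.commute) simp
    also have "(Suc (2 * k) choose k) = (Suc (2 * k) choose Suc k)"
      using binomial_symmetric[of k "Suc (2 * k)"] by (simp add: Suc_diff_le)
    finally show ?thesis using Suc_times_binomial[of k "2 * k"] by (simp only: Suc_eq_plus1)
  qed
  have "order G = card ?E" using bij_betw_same_card[OF bij] by (simp add: order_def)
  then have ord: "4 dvd order G" using dvd cardE by simp
  have "card ?E > 0" unfolding cardE by simp
  then have fin: "finite (carrier G)" using bij_betw_finite[OF bij] card_gt_0_iff by blast
  let ?f' = "inv_into (carrier G) f"
  define \<phi> where "\<phi> g = f \<circ> (\<lambda>h. g \<otimes> h) \<circ> ?f'" for g
  have f'E: "?f' e \<in> carrier G" "f (?f' e) = e" if "e \<in> ?E" for e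
    using that bij_betwE[OF bij_betw_inv_into[OF bij]] bij_betw_inv_into_right[OF bij] by auto
  have phi_iso: "graph_iso (\<phi> g) (line_graph ?B) (line_graph ?B)" if "g \<in> carrier G" for g
    using graph_iso_comp[OF graph_iso_inv_into[OF iso] graph_iso_comp[OF graph_iso_cayley_left_mult[OF that] iso]]
    unfolding \<phi>_def C .
  have phi_E: "\<phi> g e \<in> ?E" if "g \<in> carrier G" "e \<in> ?E" for g e
    using that f'E bij_betwE[OF bij] by (simp add: \<phi>_def)
  have phi_mult: "\<phi> (g \<otimes> h) e = \<phi> g (\<phi> h e)" if "g \<in> carrier G" "h \<in> carrier G" "e \<in> ?E" for g h e
    using that f'E bij_betw_inv_into_left[OF bij] by (simp add: \<phi>_def m_assoc)
  have phi_free: "g = \<one>" if "g \<in> carrier G" "e \<in> ?E" "\<phi> g e = e" for g e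
  proof -
    have "?f' (f (g \<otimes> ?f' e)) = ?f' e" using that by (simp add: \<phi>_def)
    then have "g \<otimes> ?f' e = ?f' e" using that f'E bij_betw_inv_into_left[OF bij] by simp
    then show ?thesis using that f'E by (simp add: r_cancel_one)
  qed
  let ?perm = "\<lambda>g \<sigma>. bij_betw \<sigma> ?X ?X \<and> (\<forall>e\<in>?E. \<phi> g e = (\<lambda>v. \<sigma> ` v) ` e)"
  let ?dual = "\<lambda>g \<sigma>. bij_betw \<sigma> ?X ?X \<and> (\<forall>e\<in>?E. \<phi> g e = (\<lambda>v. ?X - \<sigma> ` v) ` e)"
  \<comment> \<open>\<open>N\<close> collects the elements acting by a permutation of the points;
    every other element acts by a permutation followed by complementation.\<close>
  define N where "N = {g \<in> carrier G. \<exists>\<sigma>. ?perm g \<sigma>}"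
  have dual: "\<exists>\<sigma>. ?dual g \<sigma>" if "g \<in> carrier G" "g \<notin> N" for g
    using automorphisms_line_graph_middle_layers[OF k(2) phi_iso[OF that(1)]] that by (auto simp: N_def)
  \<comment> \<open>Permutations of the points commute with complementation, so the two complements
    cancel in a product of elements outside \<open>N\<close>.\<close>
  have comp: "(\<sigma> \<circ> \<tau>) ` v = ?X - \<sigma> ` (?X - \<tau> ` v)"
    if "bij_betw \<sigma> ?X ?X" "bij_betw \<tau> ?X ?X" "v \<subseteq> ?X" for \<sigma> \<tau> v
  proof -
    have tv: "\<tau> ` v \<subseteq> ?X" using that(2,3) unfolding bij_betw_def by blast
    have sX: "\<sigma> ` ?X = ?X" using that(1) by (rule bij_betw_imp_surj_on)
    have "\<sigma> ` (?X - \<tau> ` v) = \<sigma> ` ?X - \<sigma> ` \<tau> ` v"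
      using tv by (intro inj_on_image_set_diff[OF bij_betw_imp_inj_on[OF that(1)]]) blast+
    moreover have "\<sigma> ` \<tau> ` v \<subseteq> ?X" using tv sX by blast
    ultimately have "?X - \<sigma> ` (?X - \<tau> ` v) = \<sigma> ` \<tau> ` v"
      unfolding sX by (simp only: double_diff subset_refl)
    then show ?thesis by (simp only: image_comp)
  qed
  have "\<exists>g \<in> carrier G \<inter> N. g \<noteq> \<one> \<and> g \<otimes> g = \<one>"
  proof (rule involution_in_index_two_set[OF fin ord])
    fix a b assume ab: "a \<in> carrier G" "b \<in> carrier G" "a \<in> N \<longleftrightarrow> b \<in> N"
    have "\<exists>\<sigma>. ?perm (a \<otimes> b) \<sigma>"
    proof (cases "a \<in> N")
      case True
      then obtain \<sigma> \<tau> where st: "?perm a \<sigma>" "?perm b \<tau>" using ab(3) by (auto simp: N_def)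
      have "\<phi> (a \<otimes> b) e = (\<lambda>v. (\<sigma> \<circ> \<tau>) ` v) ` e" if "e \<in> ?E" for e
      proof -
        have "\<phi> (a \<otimes> b) e = (\<lambda>v. \<sigma> ` v) ` (\<lambda>v. \<tau> ` v) ` e"
          using phi_mult[OF ab(1,2) that] phi_E[OF ab(2) that] st that by metis
        then show ?thesis by (simp add: image_comp comp_def)
      qed
      then show ?thesis
        by (intro exI[of _ "\<sigma> \<circ> \<tau>"] conjI ballI bij_betw_trans[OF conjunct1[OF st(2)] conjunct1[OF st(1)]])
    next
      case False
      then obtain \<sigma> \<tau> where st: "?dual a \<sigma>" "?dual b \<tau>" using ab dual by meson
      have "\<phi> (a \<otimes> b) e = (\<lambda>v. (\<sigma> \<circ> \<tau>) ` v) ` e" if e: "e \<in> ?E" for e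
      proof -
        have "\<phi> (a \<otimes> b) e = (\<lambda>v. ?X - \<sigma> ` v) ` (\<lambda>v. ?X - \<tau> ` v) ` e"
          using phi_mult[OF ab(1,2) e] phi_E[OF ab(2) e] st e by metis
        also have "\<dots> = (\<lambda>v. ?X - \<sigma> ` (?X - \<tau> ` v)) ` e" by (simp add: image_comp comp_def)
        also have "\<dots> = (\<lambda>v. (\<sigma> \<circ> \<tau>) ` v) ` e"
        proof (rule image_cong[OF refl])
          fix v assume "v \<in> e"
          then have "v \<subseteq> ?X" using simple_B_graph[OF e] vert_B_graphD(1) by blast
          then show "?X - \<sigma> ` (?X - \<tau> ` v) = (\<sigma> \<circ> \<tau>) ` v" using comp st by metis
        qed
        finally show ?thesis .
      qed
      then show ?thesis
        by (intro exI[of _ "\<sigma> \<circ> \<tau>"] conjI ballI bij_betw_trans[OF conjunct1[OF st(2)] conjunct1[OF st(1)]])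
    qed
    then show "a \<otimes> b \<in> N" using ab by (simp add: N_def)
  qed
  then obtain g where g: "g \<in> carrier G" "g \<noteq> \<one>" "g \<otimes> g = \<one>" "g \<in> N" by blast
  then obtain \<sigma> where s: "bij_betw \<sigma> ?X ?X" "\<And>e. e \<in> ?E \<Longrightarrow> \<phi> g e = (\<lambda>v. \<sigma> ` v) ` e"
    by (auto simp: N_def)
  have phi_one: "\<phi> \<one> e = e" if "e \<in> ?E" for e using that f'E by (simp add: \<phi>_def)
  \<comment> \<open>That \<open>g\<close> is an involution gives at first only that the square of
    \<open>\<sigma>\<close> fixes every edge; the passage to points follows.\<close>
  have sq: "(\<lambda>v. \<sigma> ` v) ` (\<lambda>v. \<sigma> ` v) ` e = e" if "e \<in> ?E" for e
    using phi_mult[OF g(1,1) that] phi_one[OF that] g(3) s(2)[OF that] s(2)[OF phi_E[OF g(1) that]]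
    by simp
  have "\<sigma> (\<sigma> x) = x" if "x \<in> ?X" for x
    by (rule involution_if_edge_involution[OF _ _ s(1) sq that]) (use k in auto)
  moreover have "\<sigma> ` ?X \<subseteq> ?X" using s(1) by (simp add: bij_betw_def)
  ultimately obtain e where "e \<in> ?E" "(\<lambda>v. \<sigma> ` v) ` e = e"
    using involution_fixes_edge[OF k(1), of \<sigma>] by blast
  then show False using phi_free[OF g(1)] s(2) g(2) by metis
qed

theorem theorem3p22:
  fixes k :: nat
  assumes "even k" and "k > 2"
    and "\<not> (\<exists>t::nat. t \<ge> 2 \<and> k = 2 ^ t)"
  shows "vertex_transitive (line_graph (B_graph (2 * k + 1) k)) \<and>
         \<not> is_cayley_over TYPE('g) (line_graph (B_graph (2 * k + 1) k))"
proof
  show "vertex_transitive (line_graph (B_graph (2 * k + 1) k))"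
    by (rule vertex_transitive_line_graph_B_graph)
  \<comment> \<open>The exponents 0 and 1, left open by the hypothesis on \<open>t\<close>, are
    ruled out by \<open>k > 2\<close>.\<close>
  have "\<nexists>t. k = 2 ^ t"
  proof
    assume "\<exists>t. k = 2 ^ t"
    then obtain t where t: "k = 2 ^ t" by blast
    have "t \<ge> 2"
    proof (rule ccontr)
      assume "\<not> t \<ge> 2"
      then have "t = 0 \<or> t = 1" by auto
      then show False using t assms(2) by auto
    qed
    then show False using assms(3) t by blast
  qed
  then have "4 dvd (2 * k choose k)" using assms(2) by (intro four_dvd_central_binomial) auto
  from group.not_cayley_line_graph_middle_layers[OF _ assms(1) _ this]
  show "\<not> is_cayley_over TYPE('g) (line_graph (B_graph (2 * k + 1) k))"
    using assms(2) unfolding is_cayley_over_def isomorphic_graphs_def by (meson less_imp_le)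
qed

end
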